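(* Let $m\geq 1$ be an integer. Equip the unitary group $\mathrm{U}(m)$ with one of the following two $\mathbb{Z}_2$-actions: (class BDI) $gA=\overline{A}$; or (class CII) $m$ is even and $gA=(I_{m/2}\otimes\sigma_2)\,\overline{A}\,(I_{m/2}\otimes\sigma_2)$. In either case there is a bijection of sets $$\left[\left(I,\partial I\right),\left(\mathrm{U}(m),I_m\right)\right]_{\mathbb{Z}_2}\cong\mathbb{Z}.$$
   Context: $I_m$ is the $m\times m$ identity matrix, $\overline{A}$ is the entrywise complex conjugate, and $\sigma_2=\begin{pmatrix}0&-\mathrm{i}\\ \mathrm{i}&0\end{pmatrix}$. $g$ denotes the nontrivial element of $\mathbb{Z}_2$. The interval $I=[-\pi,\pi]$ carries the $\mathbb{Z}_2$-action $gk=-k$. For a $\mathbb{Z}_2$-space $X$ with fixed point $x_0$, $[(I,\partial I),(X,x_0)]_{\mathbb{Z}_2}$ is the set of homotopy classes of continuous $\mathbb{Z}_2$-equivariant maps $f\colon I\to X$ (that is, $f(-k)=gf(k)$) with $f(-\pi)=f(\pi)=x_0$, where homotopies are through such maps. *)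

theory Defs
  imports "HOL-Analysis.Analysis" "Jordan_Normal_Form.Schur_Decomposition"
begin

text \<open>Maps out of the interval are total functions on \<open>real\<close>. Only their restrictions to
  \<open>{-pi..pi}\<close> matter: two such maps that agree on the interval are related by
  \<^const>\<open>homotopic_with\<close>, hence represent the same class.\<close>

definition equivariant_loop :: "('a \<Rightarrow> 'a) \<Rightarrow> 'a \<Rightarrow> (real \<Rightarrow> 'a) \<Rightarrow> bool" where
  "equivariant_loop g x0 f \<longleftrightarrow>
     (\<forall>k\<in>{-pi..pi}. f (- k) = g (f k)) \<and> f (- pi) = x0 \<and> f pi = x0"

definition equivariant_loops :: "'a topology \<Rightarrow> ('a \<Rightarrow> 'a) \<Rightarrow> 'a \<Rightarrow> (real \<Rightarrow> 'a) set" where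
  "equivariant_loops X g x0 =
     {f. continuous_map (top_of_set {-pi..pi}) X f \<and> equivariant_loop g x0 f}"

definition equivariant_loop_classes ::
    "'a topology \<Rightarrow> ('a \<Rightarrow> 'a) \<Rightarrow> 'a \<Rightarrow> (real \<Rightarrow> 'a) set set" where
  "equivariant_loop_classes X g x0 =
     equivariant_loops X g x0 //
       {(f, h). homotopic_with (equivariant_loop g x0) (top_of_set {-pi..pi}) X f h}"

definition unitary_group :: "nat \<Rightarrow> complex mat set" where
  "unitary_group m =
     {A \<in> carrier_mat m m. mat_adjoint A * A = 1\<^sub>m m \<and> A * mat_adjoint A = 1\<^sub>m m}"

text \<open>The type \<open>complex mat\<close> carries no topology, so \<open>m \<times> m\<close> matrices receive the
  product topology of their \<open>m\<^sup>2\<close> entries.\<close>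

definition mat_topology :: "nat \<Rightarrow> complex mat topology" where
  "mat_topology m =
     pullback_topology (carrier_mat m m)
       (\<lambda>A. restrict (\<lambda>ij. A $$ ij) ({..<m} \<times> {..<m}))
       (product_topology (\<lambda>_. euclidean) ({..<m} \<times> {..<m}))"

definition unitary_topology :: "nat \<Rightarrow> complex mat topology" where
  "unitary_topology m = subtopology (mat_topology m) (unitary_group m)"

definition kronecker_mat :: "'a::times mat \<Rightarrow> 'a mat \<Rightarrow> 'a mat" where
  "kronecker_mat A B =
     Matrix.mat (dim_row A * dim_row B) (dim_col A * dim_col B)
       (\<lambda>(i, j). A $$ (i div dim_row B, j div dim_col B) * B $$ (i mod dim_row B, j mod dim_col B))"

definition sigma2 :: "complex mat" where
  "sigma2 = mat_of_rows_list 2 [[0, - \<i>], [\<i>, 0]]"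

definition BDI_action :: "complex mat \<Rightarrow> complex mat" where
  "BDI_action A = map_mat cnj A"

definition CII_action :: "nat \<Rightarrow> complex mat \<Rightarrow> complex mat" where
  "CII_action m A =
     kronecker_mat (1\<^sub>m (m div 2)) sigma2 * map_mat cnj A * kronecker_mat (1\<^sub>m (m div 2)) sigma2"

end

theory Submission
  imports Defs
begin

text \<open>
  An equivariant loop is determined by its restriction to \<open>[0, pi]\<close>, a path in \<open>U(m)\<close> from the
  fixed group \<open>K\<close> (\<open>O(m)\<close> or \<open>Sp(m/2)\<close>) to the identity. Lifting the determinant to a logarithm
  gives an integer, the number of half turns, which is a homotopy invariant. Conversely every such
  path can be deformed to \<open>diag(1, ..., 1, exp(\<i> n (pi - t)))\<close>: the initial point is first moved
  inside \<open>K\<close> to \<open>diag(1, ..., 1, \<plusminus> 1)\<close>, which reduces the problem to loops, and a loop in \<open>U(m)\<close> is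
  pushed into \<open>U(m - 1)\<close> by a rotation taking its first column to the first basis vector.

  This rotation is a product of two Householder-type unitaries \<open>1 - u c\<^sup>-\<^sup>1 u\<^sup>*\<close> with
  \<open>c + c\<^sup>* = u\<^sup>* u\<close>. It is joined to the identity by an explicit family, continuous as long as the
  first column is not \<open>- e\<^sub>1\<close>, and the same formula with \<open>2 \<times> 2\<close> blocks stays inside the quaternionic
  matrices. It therefore also shows that \<open>Sp(n)\<close> is connected and that \<open>O(m)\<close> has at most two
  components. The values of \<open>n\<close> that occur are all integers for \<open>O(m)\<close> and the even ones for
  \<open>Sp(m/2)\<close>, since \<open>diag(1, ..., 1, - 1)\<close> is real but not quaternionic.
\<close>

section \<open>Continuous families of matrices\<close>

text \<open>What shapes the proof is the excluded vector \<open>- e_1\<close>, at which the rotating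
  family breaks down. For a loop it is avoided by general position: a path in the complex plane can
  be perturbed off 0, so tilting one entry of the column is enough, and this is done only where the
  column is near the bad vector, hence away from the end points. For a single matrix of the fixed
  group a plane rotation by pi suffices. The exception is size 1, where the two signs of
  \<open>O(1)\<close> stay apart and leave the possible second component.

  The invariant counts half turns because a determinant equal to its own conjugate, and of modulus
  1, is 1 or -1, so the path of determinants may start at either sign. One formula serves both
  classes because the inverse of \<open>c\<close> is computed from \<open>c\<close> by adjoints and
  real scalars only. This works in the complex numbers as well as in the quaternions, and it never
  leaves the real or the quaternionic matrices.\<close>

definition mat_continuous ::
  "'a topology \<Rightarrow> nat \<Rightarrow> nat \<Rightarrow> ('a \<Rightarrow> complex mat) \<Rightarrow> bool" where
  "mat_continuous X r c F \<longleftrightarrow>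
     (\<forall>x\<in>topspace X. F x \<in> carrier_mat r c) \<and>
     (\<forall>i<r. \<forall>j<c. continuous_map X euclidean (\<lambda>x. F x $$ (i, j)))"

lemma mat_continuousI:
  assumes "\<And>x. x \<in> topspace X \<Longrightarrow> F x \<in> carrier_mat r c"
    and "\<And>i j. \<lbrakk>i < r; j < c\<rbrakk> \<Longrightarrow> continuous_map X euclidean (\<lambda>x. F x $$ (i, j))"
  shows "mat_continuous X r c F"
  using assms unfolding mat_continuous_def by blast

lemma mat_continuousD:
  assumes "mat_continuous X r c F"
  shows "x \<in> topspace X \<Longrightarrow> F x \<in> carrier_mat r c"
    and "\<lbrakk>i < r; j < c\<rbrakk> \<Longrightarrow> continuous_map X euclidean (\<lambda>x. F x $$ (i, j))"
  using assms unfolding mat_continuous_def by blast+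

lemma mat_continuous_dim:
  assumes "mat_continuous X r c F" "x \<in> topspace X"
  shows "dim_row (F x) = r" "dim_col (F x) = c"
  using mat_continuousD(1)[OF assms] by auto

text \<open>\<open>mat_topology\<close> is the initial topology for the map to the entries, so
  continuity into it is continuity of the entries. Continuity is therefore always proved for
  \<open>mat_continuous\<close>, which also covers the rectangular factors of the rotations.\<close>

lemma continuous_map_mat_topology:
  "continuous_map X (mat_topology m) F \<longleftrightarrow> mat_continuous X m m F"
proof
  assume L: "continuous_map X (mat_topology m) F"
  let ?e = "\<lambda>A::complex mat. restrict (\<lambda>ij. A $$ ij) ({..<m} \<times> {..<m})"
  have car: "F x \<in> carrier_mat m m" if "x \<in> topspace X" for x
    using continuous_map_image_subset_topspace[OF L] that
    by (auto simp: mat_topology_def topspace_pullback_topology)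
  have "continuous_map (mat_topology m) (product_topology (\<lambda>_. euclidean) ({..<m} \<times> {..<m})) (id \<circ> ?e)"
    unfolding mat_topology_def by (rule continuous_map_pullback) simp
  then have "continuous_map X (product_topology (\<lambda>_. euclidean) ({..<m} \<times> {..<m})) (id \<circ> ?e \<circ> F)"
    using L continuous_map_compose by blast
  then have *: "continuous_map X euclidean (\<lambda>x. (id \<circ> ?e \<circ> F) x (i,j))" if "i < m" "j < m" for i j
    using that by (auto simp: continuous_map_componentwise)
  have "continuous_map X euclidean (\<lambda>x. F x $$ (i,j))" if "i < m" "j < m" for i j
    using *[OF that] that by simp
  with car show "mat_continuous X m m F" by (auto simp: mat_continuous_def)
next
  assume R: "mat_continuous X m m F"
  show "continuous_map X (mat_topology m) F"
    unfolding mat_topology_def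
    using R by (intro continuous_map_pullback')
      (auto simp: continuous_map_componentwise mat_continuous_def)
qed

lemma continuous_map_unitary_topology:
  "continuous_map X (unitary_topology m) F \<longleftrightarrow>
     mat_continuous X m m F \<and> (\<forall>x\<in>topspace X. F x \<in> unitary_group m)"
  unfolding unitary_topology_def continuous_map_in_subtopology continuous_map_mat_topology by auto

lemma topspace_unitary_topology [simp]: "topspace (unitary_topology m) = unitary_group m"
  by (auto simp: unitary_topology_def mat_topology_def topspace_pullback_topology unitary_group_def)

lemma continuous_map_compose2:
  assumes "continuous_map X euclidean f" "continuous_map X euclidean g"
    "continuous_on UNIV (\<lambda>z. h (fst z) (snd z))"
  shows "continuous_map X euclidean (\<lambda>x. h (f x) (g x))"
proof -
  have "continuous_map X (prod_topology euclidean euclidean) (\<lambda>x. (f x, g x))"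
    using assms(1,2) by (simp add: continuous_map_pairwise o_def del: prod_topology_euclidean)
  then have "continuous_map X euclidean (\<lambda>x. (f x, g x))" by simp
  moreover have "continuous_map euclidean euclidean (\<lambda>z. h (fst z) (snd z))"
    using assms(3) by simp
  ultimately have "continuous_map X euclidean ((\<lambda>z. h (fst z) (snd z)) \<circ> (\<lambda>x. (f x, g x)))"
    by (rule continuous_map_compose)
  then show ?thesis by (simp add: o_def)
qed

lemma continuous_map_mult:
  fixes f g :: "'a \<Rightarrow> 'b::real_normed_algebra"
  assumes "continuous_map X euclidean f" "continuous_map X euclidean g"
  shows "continuous_map X euclidean (\<lambda>x. f x * g x)"
  by (rule continuous_map_compose2[OF assms]) (intro continuous_intros)

lemma continuous_map_compose1:
  assumes "continuous_map X euclidean f" "continuous_on UNIV h"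
  shows "continuous_map X euclidean (\<lambda>x. h (f x))"
  using continuous_map_compose[of X euclidean f euclidean h] assms by (simp add: o_def)

lemma continuous_map_inverse:
  fixes f :: "'a \<Rightarrow> complex"
  assumes "continuous_map X euclidean f" "\<And>x. x \<in> topspace X \<Longrightarrow> f x \<noteq> 0"
  shows "continuous_map X euclidean (\<lambda>x. inverse (f x))"
proof -
  have "continuous_map X (top_of_set (- {0})) f"
    using assms by (auto simp: continuous_map_in_subtopology)
  moreover have "continuous_map (top_of_set (- {0})) euclidean (inverse :: complex \<Rightarrow> complex)"
    by (auto intro!: continuous_intros)
  ultimately have "continuous_map X euclidean (inverse \<circ> f)"
    by (rule continuous_map_compose)
  then show ?thesis by (simp add: o_def)
qed

lemma continuous_map_prod:
  fixes f :: "'i \<Rightarrow> 'a \<Rightarrow> 'b::{real_normed_algebra, comm_ring_1}"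
  assumes "\<And>i. i \<in> I \<Longrightarrow> continuous_map X euclidean (f i)"
  shows "continuous_map X euclidean (\<lambda>x. \<Prod>i\<in>I. f i x)"
  using assms by (induction I rule: infinite_finite_induct) (auto intro: continuous_map_mult)

lemma mat_continuous_const: "A \<in> carrier_mat r c \<Longrightarrow> mat_continuous X r c (\<lambda>_. A)"
  by (auto simp: mat_continuous_def)

lemma mat_continuous_mult:
  assumes F: "mat_continuous X r n F" and G: "mat_continuous X n c G"
  shows "mat_continuous X r c (\<lambda>x. F x * G x)"
proof (rule mat_continuousI)
  fix i j assume ij: "i < r" "j < c"
  have "continuous_map X euclidean (\<lambda>x. \<Sum>l\<in>{0..<n}. F x $$ (i,l) * G x $$ (l,j))"
    using ij by (intro continuous_map_sum continuous_map_mult mat_continuousD(2)[OF F]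
        mat_continuousD(2)[OF G]) auto
  moreover have "(F x * G x) $$ (i,j) = (\<Sum>l\<in>{0..<n}. F x $$ (i,l) * G x $$ (l,j))"
    if "x \<in> topspace X" for x
    using that ij
    by (simp add: scalar_prod_def mat_continuous_dim[OF F] mat_continuous_dim[OF G])
  ultimately show "continuous_map X euclidean (\<lambda>x. (F x * G x) $$ (i,j))"
    by (simp add: continuous_map_eq)
qed (auto intro!: carrier_matI simp: mat_continuous_dim[OF F] mat_continuous_dim[OF G])

lemma mat_continuous_add:
  assumes F: "mat_continuous X r c F" and G: "mat_continuous X r c G"
  shows "mat_continuous X r c (\<lambda>x. F x + G x)"
proof (rule mat_continuousI)
  fix i j assume ij: "i < r" "j < c"
  have "continuous_map X euclidean (\<lambda>x. F x $$ (i,j) + G x $$ (i,j))"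
    using ij by (intro continuous_map_add mat_continuousD(2)[OF F] mat_continuousD(2)[OF G])
  then show "continuous_map X euclidean (\<lambda>x. (F x + G x) $$ (i,j))"
    by (rule continuous_map_eq) (simp add: ij mat_continuous_dim[OF F] mat_continuous_dim[OF G])
qed (auto intro!: carrier_matI simp: mat_continuous_dim[OF F] mat_continuous_dim[OF G])

lemma mat_continuous_minus:
  assumes F: "mat_continuous X r c F" and G: "mat_continuous X r c G"
  shows "mat_continuous X r c (\<lambda>x. F x - G x)"
proof (rule mat_continuousI)
  fix i j assume ij: "i < r" "j < c"
  have "continuous_map X euclidean (\<lambda>x. F x $$ (i,j) - G x $$ (i,j))"
    using ij by (intro continuous_map_diff mat_continuousD(2)[OF F] mat_continuousD(2)[OF G])
  then show "continuous_map X euclidean (\<lambda>x. (F x - G x) $$ (i,j))"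
    by (rule continuous_map_eq) (simp add: ij mat_continuous_dim[OF F] mat_continuous_dim[OF G])
qed (auto intro!: carrier_matI simp: mat_continuous_dim[OF F] mat_continuous_dim[OF G])

lemma mat_continuous_smult:
  assumes a: "continuous_map X euclidean a" and F: "mat_continuous X r c F"
  shows "mat_continuous X r c (\<lambda>x. a x \<cdot>\<^sub>m F x)"
proof (rule mat_continuousI)
  fix i j assume ij: "i < r" "j < c"
  have "continuous_map X euclidean (\<lambda>x. a x * F x $$ (i,j))"
    using ij by (intro continuous_map_mult a mat_continuousD(2)[OF F])
  then show "continuous_map X euclidean (\<lambda>x. (a x \<cdot>\<^sub>m F x) $$ (i,j))"
    by (rule continuous_map_eq) (simp add: ij mat_continuous_dim[OF F])
qed (auto intro!: carrier_matI simp: mat_continuous_dim[OF F])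

section \<open>Adjoints, matrix arithmetic and the unitary group\<close>

abbreviation adj :: "complex mat \<Rightarrow> complex mat" where
  "adj \<equiv> mat_adjoint"

lemma adj_dim [simp]: "dim_row (adj A) = dim_col A" "dim_col (adj A) = dim_row A"
  by (auto simp: mat_adjoint_def)

lemma adj_carrier [simp]: "A \<in> carrier_mat r c \<Longrightarrow> adj A \<in> carrier_mat c r"
  by (rule carrier_matI) simp_all

lemma adj_index [simp]: "\<lbrakk>i < dim_col A; j < dim_row A\<rbrakk> \<Longrightarrow> adj A $$ (i, j) = cnj (A $$ (j, i))"
  by (simp add: mat_adjoint_def mat_of_rows_def)

lemma mat_continuous_adj:
  assumes F: "mat_continuous X r c F"
  shows "mat_continuous X c r (\<lambda>x. adj (F x))"
proof (rule mat_continuousI)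
  fix i j assume ij: "i < c" "j < r"
  have "continuous_map X euclidean (\<lambda>x. cnj (F x $$ (j,i)))"
    using mat_continuousD(2)[OF F ij(2,1)]
    by (rule continuous_map_compose1) (intro continuous_intros)
  then show "continuous_map X euclidean (\<lambda>x. adj (F x) $$ (i,j))"
    by (rule continuous_map_eq) (simp add: ij mat_continuous_dim[OF F])
qed (auto intro!: carrier_matI simp: mat_continuous_dim[OF F])

lemma mat_continuous_det:
  assumes F: "mat_continuous X m m F"
  shows "continuous_map X euclidean (\<lambda>x. det (F x))"
proof -
  have "continuous_map X euclidean
     (\<lambda>x. \<Sum>p | p permutes {0..<m}. signof p * (\<Prod>i = 0..<m. F x $$ (i, p i)))"
    by (intro continuous_map_sum continuous_map_mult continuous_map_prod mat_continuousD(2)[OF F]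
        finite_permutations) (auto simp: permutes_in_image[of _ "{0..<m}", simplified])
  then show ?thesis
    by (rule continuous_map_eq) (simp add: det_def'[OF mat_continuousD(1)[OF F]])
qed

text \<open>Side conditions stated as equations between dimensions can be discharged by
  simplification, without naming carriers. The distributive and scalar laws that follow have this
  form for the same reason.\<close>

lemma mat_mult_assoc:
  fixes A B C :: "'a::semiring_0 mat"
  assumes "dim_col A = dim_row B" "dim_col B = dim_row C"
  shows "A * B * C = A * (B * C)"
  using assms by (intro assoc_mult_mat[of _ "dim_row A" "dim_row B" _ "dim_row C" _ "dim_col C"]) auto

lemma mat_minus_mult:
  fixes A B C :: "'a::ring mat"
  assumes "dim_row A = dim_row B" "dim_col A = dim_col B" "dim_col B = dim_row C"
  shows "(A - B) * C = A * C - B * C"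
  using assms by (intro minus_mult_distrib_mat[of _ "dim_row B" "dim_row C" _ _ "dim_col C"]) auto

lemma mat_mult_minus:
  fixes A B C :: "'a::ring mat"
  assumes "dim_col C = dim_row B" "dim_row A = dim_row B" "dim_col A = dim_col B"
  shows "C * (A - B) = C * A - C * B"
  using assms by (intro mult_minus_distrib_mat[of _ "dim_row C" "dim_row B" _ "dim_col B"]) auto

lemma mat_add_mult:
  fixes A B C :: "'a::semiring_0 mat"
  assumes "dim_row A = dim_row B" "dim_col A = dim_col B" "dim_col B = dim_row C"
  shows "(A + B) * C = A * C + B * C"
  using assms by (intro add_mult_distrib_mat[of _ "dim_row B" "dim_row C" _ _ "dim_col C"]) auto

lemma mat_mult_add:
  fixes A B C :: "'a::semiring_0 mat"
  assumes "dim_col C = dim_row B" "dim_row A = dim_row B" "dim_col A = dim_col B"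
  shows "C * (A + B) = C * A + C * B"
  using assms by (intro mult_add_distrib_mat[of _ "dim_row C" "dim_row B" _ "dim_col B"]) auto

lemma mat_smult_mult:
  fixes A B :: "'a::comm_semiring_0 mat"
  assumes "dim_col A = dim_row B"
  shows "(a \<cdot>\<^sub>m A) * B = a \<cdot>\<^sub>m (A * B)" "A * (a \<cdot>\<^sub>m B) = a \<cdot>\<^sub>m (A * B)"
  using assms
  by (auto intro!: mult_smult_assoc_mat[of _ "dim_row A" "dim_row B"]
      mult_smult_distrib[of _ "dim_row A" "dim_row B"])

lemma adj_adj [simp]: "adj (adj A) = A"
  by (rule eq_matI) auto

lemma adj_mult:
  assumes "dim_col A = dim_row B"
  shows "adj (A * B) = adj B * adj A"
  using assms by (intro eq_matI) (auto simp: scalar_prod_def mult.commute)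

lemma adj_add: "\<lbrakk>dim_row A = dim_row B; dim_col A = dim_col B\<rbrakk> \<Longrightarrow> adj (A + B) = adj A + adj B"
  by (intro eq_matI) auto

lemma adj_minus: "\<lbrakk>dim_row A = dim_row B; dim_col A = dim_col B\<rbrakk> \<Longrightarrow> adj (A - B) = adj A - adj B"
  by (intro eq_matI) auto

lemma adj_smult: "adj (a \<cdot>\<^sub>m A) = cnj a \<cdot>\<^sub>m adj A"
  by (intro eq_matI) auto

lemma adj_one [simp]: "adj (1\<^sub>m n) = 1\<^sub>m n"
  by (intro eq_matI) auto

text \<open>A left inverse of a square matrix is also a right inverse, so one of the two defining
  equations suffices.\<close>

lemma unitary_groupI:
  assumes "A \<in> carrier_mat m m" "adj A * A = 1\<^sub>m m"
  shows "A \<in> unitary_group m"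
  using assms mat_mult_left_right_inverse[of "adj A" m A] by (auto simp: unitary_group_def)

lemma unitary_groupD:
  assumes "A \<in> unitary_group m"
  shows "A \<in> carrier_mat m m" "adj A * A = 1\<^sub>m m" "A * adj A = 1\<^sub>m m"
  using assms by (auto simp: unitary_group_def)

lemma unitary_group_mult:
  assumes "A \<in> unitary_group m" "B \<in> unitary_group m"
  shows "A * B \<in> unitary_group m"
proof (rule unitary_groupI)
  note A = unitary_groupD[OF assms(1)] and B = unitary_groupD[OF assms(2)]
  have "adj A * (A * B) = B"
    using A B by (simp flip: assoc_mult_mat[OF adj_carrier[OF A(1)] A(1) B(1)])
  then show "adj (A * B) * (A * B) = 1\<^sub>m m"
    using A(1) B(1,2) by (simp add: adj_mult mat_mult_assoc)
qed (use unitary_groupD(1)[OF assms(1)] unitary_groupD(1)[OF assms(2)] in auto)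

lemma unitary_group_adj: "A \<in> unitary_group m \<Longrightarrow> adj A \<in> unitary_group m"
  by (auto simp: unitary_group_def)

lemma unitary_group_one [simp]: "1\<^sub>m m \<in> unitary_group m"
  by (rule unitary_groupI) auto

section \<open>The Householder family\<close>

text \<open>The first \<open>k\<close> standard basis vectors, called E below. Multiplication by it
  on the right selects the first \<open>k\<close> columns, multiplication by its adjoint on the left
  the first \<open>k\<close> rows.\<close>

definition frame :: "nat \<Rightarrow> nat \<Rightarrow> complex mat" where
  "frame m k = Matrix.mat m k (\<lambda>(i, j). if i = j then 1 else 0)"

text \<open>The diagonal matrix with \<open>k\<close> entries -1 followed by entries 1. It is the
  value at \<open>s = 0\<close> of the other factor of \<open>householder\<close>, so that the
  product starts at the identity.\<close>

definition flip :: "nat \<Rightarrow> nat \<Rightarrow> complex mat" where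
  "flip m k = 1\<^sub>m m - 2 \<cdot>\<^sub>m (frame m k * adj (frame m k))"

definition first_col_norm2 :: "complex mat \<Rightarrow> real" where
  "first_col_norm2 c = (\<Sum>i<dim_row c. (cmod (c $$ (i, 0)))\<^sup>2)"

text \<open>Half of the Gram matrix of \<open>u = s V + E\<close>, but with the cross terms gathered
  on one side instead of symmetrised. This choice makes the pivot equal to \<open>adj u * V\<close>
  at \<open>s = 1\<close>, which is why the family ends by sending \<open>V\<close> to E.\<close>

definition pivot :: "nat \<Rightarrow> nat \<Rightarrow> real \<Rightarrow> complex mat \<Rightarrow> complex mat" where
  "pivot m k s V = complex_of_real ((1 + s\<^sup>2) / 2) \<cdot>\<^sub>m 1\<^sub>m k + complex_of_real s \<cdot>\<^sub>m (adj (frame m k) * V)"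

text \<open>With \<open>u = s V + E\<close> and \<open>V\<^sup>* V = 1\<close> the pivot \<open>c\<close> satisfies \<open>c + c\<^sup>* = u\<^sup>* u\<close>. Its inverse is
  written as \<open>c\<^sup>* / N\<close>, which is correct when \<open>c\<close> is a complex number or a quaternion.\<close>

definition householder :: "nat \<Rightarrow> nat \<Rightarrow> real \<Rightarrow> complex mat \<Rightarrow> complex mat" where
  "householder m k s V =
     (let u = complex_of_real s \<cdot>\<^sub>m V + frame m k; c = pivot m k s V
      in flip m k * (1\<^sub>m m - u * (complex_of_real (1 / first_col_norm2 c) \<cdot>\<^sub>m adj c) * adj u))"

lemma frame_dim [simp]: "dim_row (frame m k) = m" "dim_col (frame m k) = k"
  by (auto simp: frame_def)

lemma frame_carrier [simp]: "frame m k \<in> carrier_mat m k"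
  by (auto intro: carrier_matI)

lemma frame_index [simp]: "\<lbrakk>i < m; j < k\<rbrakk> \<Longrightarrow> frame m k $$ (i, j) = (if i = j then 1 else 0)"
  by (auto simp: frame_def)

lemma flip_dim [simp]: "dim_row (flip m k) = m" "dim_col (flip m k) = m"
  by (auto simp: flip_def)

lemma pivot_dim [simp]: "V \<in> carrier_mat m k \<Longrightarrow> dim_row (pivot m k s V) = k"
   "V \<in> carrier_mat m k \<Longrightarrow> dim_col (pivot m k s V) = k"
  by (auto simp: pivot_def)

lemma adj_frame_mult_index:
  assumes "V \<in> carrier_mat m c" "k \<le> m" "i < k" "j < c"
  shows "(adj (frame m k) * V) $$ (i, j) = V $$ (i, j)"
proof -
  have "(adj (frame m k) * V) $$ (i, j) = (\<Sum>l\<in>{0..<m}. cnj (frame m k $$ (l, i)) * V $$ (l, j))"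
    using assms by (auto simp: scalar_prod_def)
  also have "\<dots> = (\<Sum>l\<in>{0..<m}. if l = i then V $$ (l, j) else 0)"
    using assms by (intro sum.cong) auto
  finally show ?thesis using assms by simp
qed

lemma mult_frame_index:
  assumes "A \<in> carrier_mat r m" "k \<le> m" "i < r" "j < k"
  shows "(A * frame m k) $$ (i, j) = A $$ (i, j)"
proof -
  have "(A * frame m k) $$ (i, j) = (\<Sum>l\<in>{0..<m}. A $$ (i, l) * frame m k $$ (l, j))"
    using assms by (auto simp: scalar_prod_def)
  also have "\<dots> = (\<Sum>l\<in>{0..<m}. if l = j then A $$ (i, l) else 0)"
    using assms by (intro sum.cong) auto
  finally show ?thesis using assms by simp
qed

lemma adj_frame_frame: "k \<le> m \<Longrightarrow> adj (frame m k) * frame m k = 1\<^sub>m k"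
  by (intro eq_matI) (simp_all add: adj_frame_mult_index[of _ m k] del: index_mult_mat(1))

lemma flip_mult:
  assumes "dim_row A = m"
  shows "flip m k * A = A - 2 \<cdot>\<^sub>m (frame m k * (adj (frame m k) * A))"
  using assms by (simp add: flip_def mat_minus_mult mat_smult_mult mat_mult_assoc)

lemma flip_frame: "k \<le> m \<Longrightarrow> flip m k * frame m k = - frame m k"
  by (subst flip_mult) (auto simp: adj_frame_frame)

lemma flip_flip: "k \<le> m \<Longrightarrow> flip m k * flip m k = 1\<^sub>m m"
proof -
  assume k: "k \<le> m"
  let ?E = "frame m k"
  have "adj ?E * flip m k = adj ?E - 2 \<cdot>\<^sub>m adj ?E"
    unfolding flip_def
    by (simp add: mat_mult_minus mat_smult_mult flip: mat_mult_assoc)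
      (simp add: adj_frame_frame[OF k])
  then have "flip m k * flip m k = flip m k - 2 \<cdot>\<^sub>m (?E * (adj ?E - 2 \<cdot>\<^sub>m adj ?E))"
    by (simp add: flip_mult)
  also have "\<dots> = 1\<^sub>m m"
    unfolding flip_def by (intro eq_matI) (auto simp: mat_mult_minus mat_smult_mult)
  finally show ?thesis .
qed

lemma adj_flip: "adj (flip m k) = flip m k"
proof -
  have "adj (frame m k * adj (frame m k)) = frame m k * adj (frame m k)"
    by (simp add: adj_mult)
  then show ?thesis
    unfolding flip_def by (simp add: adj_minus adj_smult)
qed

lemma unitary_flip: "k \<le> m \<Longrightarrow> flip m k \<in> unitary_group m"
  by (rule unitary_groupI) (auto simp: adj_flip flip_flip intro: carrier_matI)

text \<open>Expanding \<open>adj W * W\<close> for \<open>W = 1 - u d (adj u)\<close> leaves 1 minus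
  u times \<open>d + adj d - adj d * (c + adj c) * d\<close> times \<open>adj u\<close>, and the
  middle factor vanishes because \<open>d\<close> inverts \<open>c\<close>.\<close>

lemma unitary_rank_update:
  assumes u: "u \<in> carrier_mat m k" and c: "c \<in> carrier_mat k k" and d: "d \<in> carrier_mat k k"
    and dc: "d * c = 1\<^sub>m k" and uu: "adj u * u = c + adj c"
  shows "1\<^sub>m m - u * d * adj u \<in> unitary_group m"
proof (rule unitary_groupI)
  \<comment> \<open>The expansion needs the product in this order and its adjoint.\<close>
  have cd: "c * d = 1\<^sub>m k" using mat_mult_left_right_inverse[OF d c dc] .
  have dc': "adj d * adj c = 1\<^sub>m k"
    using cd c d by (metis adj_mult adj_one carrier_matD)
  note [simp] = carrier_matD[OF u] carrier_matD[OF c] carrier_matD[OF d]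
  let ?A = "u * (d * adj u)" and ?B = "u * (adj d * adj u)"
  have W: "1\<^sub>m m - u * d * adj u = 1\<^sub>m m - ?A" by (simp add: mat_mult_assoc)
  have "adj ?A = adj (d * adj u) * adj u"
    by (rule adj_mult) simp
  also have "adj (d * adj u) = u * adj d"
    by (simp add: adj_mult)
  finally have adjA: "adj ?A = ?B" by (simp add: mat_mult_assoc)
  have "adj (1\<^sub>m m - ?A) = 1\<^sub>m m - ?B"
    by (simp add: adj_minus adjA)
  then have "adj (1\<^sub>m m - ?A) * (1\<^sub>m m - ?A) = 1\<^sub>m m - ?A - ?B * (1\<^sub>m m - ?A)"
    by (simp add: mat_minus_mult)
  also have "?B * (1\<^sub>m m - ?A) = ?B - ?B * ?A"
    by (simp add: mat_mult_minus)
  also have "?B * ?A = u * (adj d * ((adj u * u) * (d * adj u)))"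
    by (simp add: mat_mult_assoc)
  also have "(adj u * u) * (d * adj u) = c * d * adj u + adj c * (d * adj u)"
    unfolding uu by (simp add: mat_add_mult mat_mult_assoc)
  also have "adj d * (c * d * adj u + adj c * (d * adj u)) = adj d * adj u + (adj d * adj c) * (d * adj u)"
    by (simp add: cd mat_mult_add mat_mult_assoc)
  also have "\<dots> = adj d * adj u + d * adj u" by (simp add: dc')
  also have "u * \<dots> = ?B + ?A" by (simp add: mat_mult_add)
  also have "1\<^sub>m m - ?A - (?B - (?B + ?A)) = 1\<^sub>m m" by (intro eq_matI) auto
  finally show "adj (1\<^sub>m m - u * d * adj u) * (1\<^sub>m m - u * d * adj u) = 1\<^sub>m m"
    unfolding W .
qed (use u in auto)

lemma adj_mult_self_index_0:
  assumes "V \<in> carrier_mat m k" "0 < k"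
  shows "(adj V * V) $$ (0, 0) = complex_of_real (\<Sum>i<m. (cmod (V $$ (i, 0)))\<^sup>2)"
proof -
  have "(adj V * V) $$ (0, 0) = (\<Sum>i\<in>{0..<m}. cnj (V $$ (i, 0)) * V $$ (i, 0))"
    using assms by (auto simp: scalar_prod_def)
  also have "\<dots> = (\<Sum>i<m. complex_of_real ((cmod (V $$ (i, 0)))\<^sup>2))"
    by (intro sum.cong) (auto simp: complex_norm_square mult.commute simp flip: of_real_power)
  finally show ?thesis by simp
qed

lemma isometry_first_col:
  assumes "V \<in> carrier_mat m k" "0 < k" "adj V * V = 1\<^sub>m k"
  shows "(\<Sum>i<m. (cmod (V $$ (i, 0)))\<^sup>2) = 1"
  using adj_mult_self_index_0[OF assms(1,2)] assms
  by (metis index_one_mat(1) of_real_eq_1_iff)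

lemma isometry_entry_le_1:
  assumes "V \<in> carrier_mat m k" "0 < k" "adj V * V = 1\<^sub>m k" "i < m"
  shows "cmod (V $$ (i, 0)) \<le> 1"
proof -
  have "(cmod (V $$ (i, 0)))\<^sup>2 \<le> (\<Sum>i<m. (cmod (V $$ (i, 0)))\<^sup>2)"
    using assms(4) by (intro member_le_sum) auto
  then show ?thesis using isometry_first_col[OF assms(1-3)] by (simp add: abs_square_le_1)
qed

lemma pivot_00:
  assumes "V \<in> carrier_mat m k" "0 < k" "k \<le> m"
  shows "pivot m k s V $$ (0, 0) = complex_of_real ((1 + s\<^sup>2) / 2) + complex_of_real s * V $$ (0, 0)"
  using assms by (simp add: pivot_def adj_frame_mult_index[of _ m k] del: index_mult_mat(1))

text \<open>The corner entry is \<open>(1 + s^2) / 2 + s v\<close> with v of modulus at most 1. It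
  can vanish only if \<open>(1 + s^2) / 2 \<le> s\<close>, that is for \<open>s = 1\<close>, and
  then v is the excluded value -1.\<close>

lemma pivot_norm_pos:
  assumes V: "V \<in> carrier_mat m k" "0 < k" "k \<le> m" "adj V * V = 1\<^sub>m k"
    and s: "0 \<le> s" "s \<le> 1" and V0: "V $$ (0, 0) \<noteq> - 1"
  shows "first_col_norm2 (pivot m k s V) > 0"
proof -
  let ?c = "pivot m k s V" and ?v = "V $$ (0, 0)"
  have v: "cmod ?v \<le> 1" using isometry_entry_le_1[OF V(1,2,4), of 0] V by simp
  have "?c $$ (0, 0) \<noteq> 0"
  proof
    assume "?c $$ (0, 0) = 0"
    then have eq: "complex_of_real s * ?v = - complex_of_real ((1 + s\<^sup>2) / 2)"
      unfolding pivot_00[OF V(1-3)] by (simp add: add_eq_0_iff)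
    then have "cmod (complex_of_real s * ?v) = (1 + s\<^sup>2) / 2"
      by (simp only: norm_minus_cancel norm_of_real) (simp add: add_nonneg_nonneg)
    then have "s * cmod ?v = (1 + s\<^sup>2) / 2"
      using s by (simp add: norm_mult)
    moreover have "s * cmod ?v \<le> s" using v s by (simp add: mult_left_le)
    ultimately have "(s - 1)\<^sup>2 \<le> 0" by (simp add: power2_eq_square algebra_simps)
    then have "s = 1" by simp
    with eq V0 show False by simp
  qed
  then have "0 < (cmod (?c $$ (0, 0)))\<^sup>2" by simp
  also have "\<dots> \<le> first_col_norm2 ?c"
    unfolding first_col_norm2_def using V by (intro member_le_sum) auto
  finally show ?thesis .
qed

lemma householder_gram:
  assumes V: "V \<in> carrier_mat m k" "k \<le> m" "adj V * V = 1\<^sub>m k"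
  defines "u \<equiv> \<lambda>s. complex_of_real s \<cdot>\<^sub>m V + frame m k"
  shows "adj (u s) * u s = pivot m k s V + adj (pivot m k s V)"
proof -
  note [simp] = carrier_matD[OF V(1)]
  let ?E = "frame m k"
  have "adj (u s) = complex_of_real s \<cdot>\<^sub>m adj V + adj ?E"
    unfolding u_def by (simp add: adj_add adj_smult)
  then have "adj (u s) * u s = complex_of_real s \<cdot>\<^sub>m (complex_of_real s \<cdot>\<^sub>m (adj V * V) + adj ?E * V)
      + (complex_of_real s \<cdot>\<^sub>m (adj V * ?E) + adj ?E * ?E)"
    unfolding u_def by (simp add: mat_add_mult mat_mult_add mat_smult_mult)
  moreover have "adj (pivot m k s V) = complex_of_real ((1 + s\<^sup>2) / 2) \<cdot>\<^sub>m 1\<^sub>m k + complex_of_real s \<cdot>\<^sub>m (adj V * ?E)"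
    unfolding pivot_def by (simp add: adj_add adj_smult adj_mult)
  ultimately show ?thesis
    unfolding pivot_def V(3) adj_frame_frame[OF V(2)]
    by (intro eq_matI) (auto simp: field_simps power2_eq_square)
qed

lemma smult_inverse_mult:
  assumes "c \<in> carrier_mat k k" "adj c * c = complex_of_real N \<cdot>\<^sub>m 1\<^sub>m k" "N \<noteq> 0"
  shows "(complex_of_real (1 / N) \<cdot>\<^sub>m adj c) * c = 1\<^sub>m k"
  using assms(1,3) by (simp add: mat_smult_mult assms(2)) (intro eq_matI, auto)

lemma householder_unitary:
  assumes V: "V \<in> carrier_mat m k" "0 < k" "k \<le> m" "adj V * V = 1\<^sub>m k"
    and s: "0 \<le> s" "s \<le> 1" and V0: "V $$ (0, 0) \<noteq> - 1"
    and c: "adj (pivot m k s V) * pivot m k s V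
              = complex_of_real (first_col_norm2 (pivot m k s V)) \<cdot>\<^sub>m 1\<^sub>m k"
  shows "householder m k s V \<in> unitary_group m"
proof -
  have "first_col_norm2 (pivot m k s V) \<noteq> 0"
    using pivot_norm_pos[OF V s V0] by simp
  moreover have "pivot m k s V \<in> carrier_mat k k" by (rule carrier_matI) (simp_all add: V(1))
  ultimately show ?thesis
    unfolding householder_def Let_def using V
    by (intro unitary_group_mult unitary_flip unitary_rank_update[where c = "pivot m k s V"]
        householder_gram smult_inverse_mult) (simp_all add: c)
qed

text \<open>At \<open>s = 1\<close> one has \<open>adj u * V = c\<close>, so the rank update sends
  \<open>V\<close> to \<open>V - u = - E\<close>, and \<open>flip\<close> turns this into E.\<close>

lemma householder_one:
  assumes V: "V \<in> carrier_mat m k" "0 < k" "k \<le> m" "adj V * V = 1\<^sub>m k" "V $$ (0, 0) \<noteq> - 1"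
    and c: "adj (pivot m k 1 V) * pivot m k 1 V
              = complex_of_real (first_col_norm2 (pivot m k 1 V)) \<cdot>\<^sub>m 1\<^sub>m k"
  shows "householder m k 1 V * V = frame m k"
proof -
  note [simp] = carrier_matD[OF V(1)]
  let ?E = "frame m k" and ?c = "pivot m k 1 V"
  have car: "?c \<in> carrier_mat k k" by (rule carrier_matI) (simp_all add: V(1))
  note [simp] = carrier_matD[OF car]
  define u where "u = V + ?E"
  define d where "d = complex_of_real (1 / first_col_norm2 ?c) \<cdot>\<^sub>m adj ?c"
  have u [simp]: "dim_row u = m" "dim_col u = k" by (auto simp: u_def)
  have d [simp]: "dim_row d = k" "dim_col d = k" by (auto simp: d_def)
  have "first_col_norm2 ?c \<noteq> 0" using pivot_norm_pos[OF V(1-4) _ _ V(5), of 1] by simp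
  then have dc: "d * ?c = 1\<^sub>m k"
    unfolding d_def by (rule smult_inverse_mult[OF car c])
  have "adj u * V = adj V * V + adj ?E * V"
    unfolding u_def by (simp add: adj_add mat_add_mult)
  also have "\<dots> = ?c" unfolding pivot_def V(4) by (intro eq_matI) auto
  finally have uV: "adj u * V = ?c" .
  have 1: "complex_of_real 1 \<cdot>\<^sub>m V + ?E = u" unfolding u_def by (intro eq_matI) auto
  have "householder m k 1 V * V = flip m k * (V - u * (d * (adj u * V)))"
    unfolding householder_def Let_def 1 d_def[symmetric]
    by (simp add: mat_mult_assoc mat_minus_mult)
  also have "V - u * (d * (adj u * V)) = - ?E"
    unfolding uV dc by (intro eq_matI) (auto simp: u_def)
  also have "flip m k * (- ?E) = ?E"
  proof -
    have "flip m k * (- ?E) = - (flip m k * ?E)"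
      using uminus_mult_right_mat[of "flip m k" ?E] by simp
    then show ?thesis by (simp add: flip_frame[OF V(3)])
  qed
  finally show ?thesis .
qed

text \<open>For \<open>u = a E\<close> and \<open>c = a^2 / 2\<close> the inverse is
  \<open>2 / a^2\<close>, so the scalar a cancels and both factors equal \<open>flip\<close>. The
  two uses are \<open>s = 0\<close> with \<open>a = 1\<close>, and \<open>V = E\<close> with
  \<open>a = 1 + s\<close>.\<close>

lemma householder_scalar:
  assumes "k \<le> m" "0 < k" and u: "complex_of_real s \<cdot>\<^sub>m V + frame m k = complex_of_real a \<cdot>\<^sub>m frame m k"
    and c: "pivot m k s V = complex_of_real (a\<^sup>2 / 2) \<cdot>\<^sub>m 1\<^sub>m k" and a: "a \<noteq> 0"
  shows "householder m k s V = 1\<^sub>m m"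
proof -
  let ?E = "frame m k" and ?c = "complex_of_real (a\<^sup>2 / 2) \<cdot>\<^sub>m 1\<^sub>m k"
  have "first_col_norm2 ?c = (\<Sum>i<k. if i = 0 then (a\<^sup>2 / 2)\<^sup>2 else 0)"
    unfolding first_col_norm2_def using \<open>0 < k\<close> by (intro sum.cong) (auto simp: norm_divide norm_power)
  then have N: "first_col_norm2 ?c = (a\<^sup>2 / 2)\<^sup>2" using \<open>0 < k\<close> by simp
  have d: "complex_of_real (1 / first_col_norm2 ?c) \<cdot>\<^sub>m adj ?c = complex_of_real (2 / a\<^sup>2) \<cdot>\<^sub>m 1\<^sub>m k"
    unfolding N using a by (intro eq_matI) (auto simp: power2_eq_square)
  have "complex_of_real a \<cdot>\<^sub>m ?E * (complex_of_real (2 / a\<^sup>2) \<cdot>\<^sub>m 1\<^sub>m k) * adj (complex_of_real a \<cdot>\<^sub>m ?E)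
     = complex_of_real a \<cdot>\<^sub>m (complex_of_real (2 / a\<^sup>2) \<cdot>\<^sub>m (complex_of_real a \<cdot>\<^sub>m (?E * adj ?E)))"
    by (simp add: adj_smult mat_smult_mult)
  also have "\<dots> = 2 \<cdot>\<^sub>m (?E * adj ?E)"
    using a by (intro eq_matI) (auto simp: power2_eq_square)
  finally have "householder m k s V = flip m k * flip m k"
    unfolding householder_def Let_def u c d by (simp add: flip_def)
  then show ?thesis using flip_flip assms by simp
qed

lemma householder_zero:
  assumes "V \<in> carrier_mat m k" "k \<le> m" "0 < k"
  shows "householder m k 0 V = 1\<^sub>m m"
  by (rule householder_scalar[where a = 1]) (use assms in \<open>auto intro!: eq_matI simp: pivot_def\<close>)

lemma householder_frame:
  assumes "k \<le> m" "0 < k" "0 \<le> s"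
  shows "householder m k s (frame m k) = 1\<^sub>m m"
proof (rule householder_scalar[where a = "1 + s"])
  show "pivot m k s (frame m k) = complex_of_real ((1 + s)\<^sup>2 / 2) \<cdot>\<^sub>m 1\<^sub>m k"
    unfolding pivot_def adj_frame_frame[OF assms(1)]
    by (intro eq_matI) (auto simp: power2_eq_square field_simps)
qed (use assms in \<open>auto intro!: eq_matI simp: algebra_simps\<close>)

lemma mat_continuous_householder:
  assumes s: "continuous_map X euclideanreal s" and V: "mat_continuous X m k V" and k: "0 < k"
    and N: "\<And>x. x \<in> topspace X \<Longrightarrow> first_col_norm2 (pivot m k (s x) (V x)) \<noteq> 0"
  shows "mat_continuous X m m (\<lambda>x. householder m k (s x) (V x))"
proof -
  have cs: "continuous_map X euclidean (\<lambda>x. complex_of_real (s x))"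
    using s by (rule continuous_map_compose1) (intro continuous_intros)
  have c2: "continuous_map X euclidean (\<lambda>x. complex_of_real ((1 + (s x)\<^sup>2) / 2))"
    using s by (rule continuous_map_compose1) (intro continuous_intros, simp)
  have E: "mat_continuous X m k (\<lambda>_. frame m k)" by (rule mat_continuous_const) simp
  have u: "mat_continuous X m k (\<lambda>x. complex_of_real (s x) \<cdot>\<^sub>m V x + frame m k)"
    by (intro mat_continuous_add mat_continuous_smult cs V E)
  have c: "mat_continuous X k k (\<lambda>x. pivot m k (s x) (V x))"
    unfolding pivot_def
    by (intro mat_continuous_add mat_continuous_smult cs c2 mat_continuous_mult[OF _ V] mat_continuous_adj[OF E]
        mat_continuous_const) auto
  have dim: "dim_row (pivot m k (s x) (V x)) = k" if "x \<in> topspace X" for x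
    using mat_continuous_dim[OF c that] by simp
  have "continuous_map X euclidean
     (\<lambda>x. complex_of_real (\<Sum>i<k. (cmod (pivot m k (s x) (V x) $$ (i, 0)))\<^sup>2))"
    using k mat_continuousD(2)[OF c]
    by (intro continuous_map_compose1[where h = complex_of_real] continuous_map_sum
        continuous_map_compose1[where h = "\<lambda>z. (cmod z)\<^sup>2"] continuous_intros) auto
  then have "continuous_map X euclidean (\<lambda>x. complex_of_real (first_col_norm2 (pivot m k (s x) (V x))))"
    by (rule continuous_map_eq) (simp add: first_col_norm2_def dim)
  then have "continuous_map X euclidean (\<lambda>x. inverse (complex_of_real (first_col_norm2 (pivot m k (s x) (V x)))))"
    by (rule continuous_map_inverse) (use N in simp)
  then have iN: "continuous_map X euclidean (\<lambda>x. complex_of_real (1 / first_col_norm2 (pivot m k (s x) (V x))))"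
    by (simp add: inverse_eq_divide)
  show ?thesis
    unfolding householder_def Let_def
    by (intro mat_continuous_mult[of _ _ m] mat_continuous_mult[of _ _ k] mat_continuous_minus
        mat_continuous_smult mat_continuous_adj mat_continuous_const u c iN)
      (auto intro: carrier_matI)
qed

section \<open>Rotating the first columns into place\<close>

definition block :: "nat \<Rightarrow> complex mat \<Rightarrow> complex mat" where
  "block k A = four_block_mat (1\<^sub>m k) (0\<^sub>m k (dim_col A)) (0\<^sub>m (dim_row A) k) A"

definition lower_block :: "nat \<Rightarrow> complex mat \<Rightarrow> complex mat" where
  "lower_block k B = Matrix.mat (dim_row B - k) (dim_col B - k) (\<lambda>(i, j). B $$ (i + k, j + k))"

lemma block_dim [simp]: "dim_row (block k A) = k + dim_row A" "dim_col (block k A) = k + dim_col A"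
  by (auto simp: block_def)

lemma block_index:
  assumes "i < k + dim_row A" "j < k + dim_col A"
  shows "block k A $$ (i, j) =
    (if i < k \<or> j < k then if i = j then 1 else 0 else A $$ (i - k, j - k))"
  using assms by (auto simp: block_def)

lemma block_mult:
  assumes "A \<in> carrier_mat n n" "B \<in> carrier_mat n n"
  shows "block k A * block k B = block k (A * B)"
  using assms unfolding block_def
  by (subst mult_four_block_mat[of _ k k _ n _ n _ _ k _ n]) auto

lemma adj_block: "A \<in> carrier_mat n n \<Longrightarrow> adj (block k A) = block k (adj A)"
  by (intro eq_matI) (auto simp: block_index)

lemma block_one: "block k (1\<^sub>m n) = 1\<^sub>m (k + n)"
  by (simp add: block_def)

lemma lower_block_block [simp]: "lower_block k (block k A) = A"
  by (intro eq_matI) (auto simp: lower_block_def block_index)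

lemma unitary_block: "A \<in> unitary_group n \<Longrightarrow> block k A \<in> unitary_group (k + n)"
  using unitary_groupD[of A n]
  by (intro unitary_groupI) (auto simp: adj_block block_mult[of _ n] block_one)

text \<open>The hypothesis fixes the first \<open>k\<close> columns; multiplying it by
  \<open>adj B\<close> shows that the adjoint fixes the frame too, which fixes the first
  \<open>k\<close> rows. Unitarity of the remaining block follows by cancelling
  \<open>block k\<close>, whose left inverse is \<open>lower_block k\<close>.\<close>

lemma unitary_fixing_frame:
  assumes B: "B \<in> unitary_group (k + n)" and fix_frame: "B * frame (k + n) k = frame (k + n) k"
  shows "lower_block k B \<in> unitary_group n" "B = block k (lower_block k B)"
proof -
  note BD = unitary_groupD[OF B]
  note [simp] = carrier_matD[OF BD(1)]
  let ?A = "lower_block k B"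
  have A: "?A \<in> carrier_mat n n" by (auto simp: lower_block_def)
  have cols: "B $$ (i, j) = (if i = j then 1 else 0)" if "i < k + n" "j < k" for i j
    using mult_frame_index[OF BD(1), of k i j] that by (simp add: fix_frame)
  have "adj B * frame (k + n) k = adj B * (B * frame (k + n) k)" by (simp only: fix_frame)
  also have "\<dots> = frame (k + n) k" by (simp add: BD(2) flip: mat_mult_assoc)
  finally have "adj B * frame (k + n) k = frame (k + n) k" .
  then have "cnj (B $$ (j, i)) = (if i = j then 1 else 0)" if "i < k + n" "j < k" for i j
    using mult_frame_index[OF adj_carrier[OF BD(1)], of k i j] that by simp
  then have rows: "B $$ (j, i) = (if i = j then 1 else 0)" if "i < k + n" "j < k" for i j
    using that by (metis complex_cnj_cnj complex_cnj_one complex_cnj_zero)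
  show BA: "B = block k ?A"
    by (rule eq_matI)
      (use A in \<open>auto simp: block_index cols rows\<close>, auto simp: lower_block_def)
  have "block k (adj ?A * ?A) = adj (block k ?A) * block k ?A"
    using A by (simp add: adj_block block_mult[of _ n])
  also have "\<dots> = adj B * B" by (simp only: BA[symmetric])
  also have "\<dots> = block k (1\<^sub>m n)" by (simp add: BD block_one)
  finally have "lower_block k (block k (adj ?A * ?A)) = lower_block k (block k (1\<^sub>m n))" by simp
  then have "adj ?A * ?A = 1\<^sub>m n" by simp
  then show "?A \<in> unitary_group n" using A by (rule unitary_groupI[rotated])
qed

lemma mat_continuous_block:
  assumes F: "mat_continuous X n n F"
  shows "mat_continuous X (k + n) (k + n) (\<lambda>x. block k (F x))"
proof (rule mat_continuousI)
  fix i j assume ij: "i < k + n" "j < k + n"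
  have "continuous_map X euclidean
     (\<lambda>x. if i < k \<or> j < k then if i = j then 1 else 0 else F x $$ (i - k, j - k))"
    using ij by (auto intro: mat_continuousD(2)[OF F])
  then show "continuous_map X euclidean (\<lambda>x. block k (F x) $$ (i, j))"
    by (rule continuous_map_eq) (simp add: block_index mat_continuous_dim[OF F] ij)
qed (auto intro!: carrier_matI simp: mat_continuous_dim[OF F])

lemma mat_continuous_lower_block:
  assumes F: "mat_continuous X (k + n) (k + n) F"
  shows "mat_continuous X n n (\<lambda>x. lower_block k (F x))"
proof (rule mat_continuousI)
  fix i j assume ij: "i < n" "j < n"
  have "continuous_map X euclidean (\<lambda>x. F x $$ (i + k, j + k))"
    using ij by (intro mat_continuousD(2)[OF F]) auto
  then show "continuous_map X euclidean (\<lambda>x. lower_block k (F x) $$ (i, j))"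
    by (rule continuous_map_eq) (simp add: lower_block_def mat_continuous_dim[OF F] ij)
qed (auto intro!: carrier_matI simp: lower_block_def mat_continuous_dim[OF F])

lemma mat_continuous_id_unitary: "mat_continuous (unitary_topology m) m m (\<lambda>A. A)"
  using continuous_map_id[of "unitary_topology m"]
  unfolding continuous_map_unitary_topology by (simp add: id_def)

lemma continuous_map_block:
  "continuous_map (unitary_topology n) (unitary_topology (k + n)) (block k)"
  unfolding continuous_map_unitary_topology
  using mat_continuous_block[OF mat_continuous_id_unitary] by (auto intro: unitary_block)

text \<open>The side condition says that \<open>A\<close> can be rotated to fix the first \<open>k\<close> standard
  basis vectors. Its second half is automatic for \<open>k = 1\<close> and holds for \<open>k = 2\<close> when \<open>A\<close> is
  quaternionic.\<close>

definition rotatable :: "nat \<Rightarrow> nat \<Rightarrow> complex mat \<Rightarrow> bool" where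
  "rotatable m k A \<longleftrightarrow> A $$ (0, 0) \<noteq> - 1 \<and>
     (\<forall>s. let c = pivot m k s (A * frame m k)
          in adj c * c = complex_of_real (first_col_norm2 c) \<cdot>\<^sub>m 1\<^sub>m k)"

definition rotation :: "nat \<Rightarrow> nat \<Rightarrow> real \<Rightarrow> complex mat \<Rightarrow> complex mat" where
  "rotation m k s A = householder m k s (A * frame m k)"

lemma isometry_mult_frame:
  assumes A: "A \<in> unitary_group m" and k: "0 < k" "k \<le> m"
  shows "A * frame m k \<in> carrier_mat m k" "adj (A * frame m k) * (A * frame m k) = 1\<^sub>m k"
    "(A * frame m k) $$ (0, 0) = A $$ (0, 0)"
proof -
  note AD = unitary_groupD[OF A]
  note [simp] = carrier_matD[OF AD(1)]
  show "A * frame m k \<in> carrier_mat m k" by (rule carrier_matI) simp_all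
  have "adj A * (A * frame m k) = frame m k" by (simp add: AD(2) flip: mat_mult_assoc)
  then show "adj (A * frame m k) * (A * frame m k) = 1\<^sub>m k"
    by (simp add: adj_mult mat_mult_assoc adj_frame_frame[OF k(2)])
  show "(A * frame m k) $$ (0, 0) = A $$ (0, 0)"
    using k by (intro mult_frame_index[OF AD(1)]) auto
qed

lemma rotation_unitary:
  assumes "A \<in> unitary_group m" "0 < k" "k \<le> m" "rotatable m k A" "0 \<le> s" "s \<le> 1"
  shows "rotation m k s A \<in> unitary_group m"
  unfolding rotation_def using assms(4)
  by (intro householder_unitary)
    (simp_all add: isometry_mult_frame[OF assms(1-3)] assms rotatable_def Let_def)

lemma rotation_zero:
  assumes "A \<in> unitary_group m" "0 < k" "k \<le> m"
  shows "rotation m k 0 A = 1\<^sub>m m"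
  unfolding rotation_def using assms
  by (intro householder_zero isometry_mult_frame(1)[OF assms]) auto

text \<open>The first columns of the identity are the frame itself, where the family is constant in
  \<open>s\<close>. This keeps the end points of a loop in place while the loop is rotated.\<close>

lemma rotation_one_mat:
  assumes "0 < k" "k \<le> m" "0 \<le> s"
  shows "rotation m k s (1\<^sub>m m) = 1\<^sub>m m"
  unfolding rotation_def using assms by (simp add: householder_frame)

lemma rotation_one:
  assumes "A \<in> unitary_group (k + n)" "0 < k" "rotatable (k + n) k A"
  shows "lower_block k (rotation (k + n) k 1 A * A) \<in> unitary_group n"
    "rotation (k + n) k 1 A * A = block k (lower_block k (rotation (k + n) k 1 A * A))"
proof -
  let ?B = "rotation (k + n) k 1 A * A"
  have R: "rotation (k + n) k 1 A \<in> unitary_group (k + n)"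
    using assms by (intro rotation_unitary) auto
  have "?B * frame (k + n) k = rotation (k + n) k 1 A * (A * frame (k + n) k)"
    using unitary_groupD(1)[OF R] unitary_groupD(1)[OF assms(1)] by (simp add: mat_mult_assoc)
  also have "\<dots> = frame (k + n) k"
    unfolding rotation_def using assms
    by (intro householder_one)
      (simp_all add: isometry_mult_frame[OF assms(1,2)] rotatable_def Let_def)
  finally have "?B * frame (k + n) k = frame (k + n) k" .
  moreover have "?B \<in> unitary_group (k + n)"
    by (intro unitary_group_mult R assms)
  ultimately show "lower_block k ?B \<in> unitary_group n" "?B = block k (lower_block k ?B)"
    by (intro unitary_fixing_frame; simp)+
qed

text \<open>Matrix and parameter vary together so that one statement serves two purposes: deforming
  a loop, with \<open>s\<close> the homotopy parameter, and joining a fixed matrix to a block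
  matrix, with \<open>F\<close> constant and \<open>s\<close> the path parameter.\<close>

lemma continuous_map_rotation:
  assumes F: "continuous_map X (unitary_topology m) F" and s: "continuous_map X euclideanreal s"
    and sx: "\<And>x. x \<in> topspace X \<Longrightarrow> 0 \<le> s x \<and> s x \<le> 1"
    and k: "0 < k" "k \<le> m" and rot: "\<And>x. x \<in> topspace X \<Longrightarrow> rotatable m k (F x)"
  shows "continuous_map X (unitary_topology m) (\<lambda>x. rotation m k (s x) (F x) * F x)"
  unfolding continuous_map_unitary_topology
proof (intro conjI ballI)
  have FU: "F x \<in> unitary_group m" if "x \<in> topspace X" for x
    using F that unfolding continuous_map_unitary_topology by blast
  have Fc: "mat_continuous X m m F" using F unfolding continuous_map_unitary_topology by blast
  have "mat_continuous X m m (\<lambda>x. rotation m k (s x) (F x))"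
    unfolding rotation_def
  proof (rule mat_continuous_householder[OF s _ k(1)])
    show "mat_continuous X m k (\<lambda>x. F x * frame m k)"
      by (intro mat_continuous_mult[OF Fc] mat_continuous_const) simp
    fix x assume x: "x \<in> topspace X"
    have "0 < first_col_norm2 (pivot m k (s x) (F x * frame m k))"
      using rot[OF x] sx[OF x] k
      by (intro pivot_norm_pos) (simp_all add: isometry_mult_frame[OF FU[OF x]] rotatable_def)
    then show "first_col_norm2 (pivot m k (s x) (F x * frame m k)) \<noteq> 0" by simp
  qed
  then show "mat_continuous X m m (\<lambda>x. rotation m k (s x) (F x) * F x)"
    by (rule mat_continuous_mult[OF _ Fc])
  show "rotation m k (s x) (F x) * F x \<in> unitary_group m" if "x \<in> topspace X" for x
    using that FU sx rot k by (intro unitary_group_mult rotation_unitary) auto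
qed

lemma first_col_norm2_1x1:
  assumes "c \<in> carrier_mat 1 1"
  shows "adj c * c = complex_of_real (first_col_norm2 c) \<cdot>\<^sub>m 1\<^sub>m 1"
proof (rule eq_matI)
  fix i j assume "i < dim_row (complex_of_real (first_col_norm2 c) \<cdot>\<^sub>m 1\<^sub>m 1)"
    "j < dim_col (complex_of_real (first_col_norm2 c) \<cdot>\<^sub>m 1\<^sub>m 1)"
  then have ij: "i = 0" "j = 0" by auto
  show "(adj c * c) $$ (i, j) = (complex_of_real (first_col_norm2 c) \<cdot>\<^sub>m 1\<^sub>m 1) $$ (i, j)"
    unfolding ij adj_mult_self_index_0[OF assms, simplified]
    using assms by (simp add: first_col_norm2_def)
qed (use assms in auto)

lemma rotatable_1:
  assumes "A \<in> carrier_mat m m" "A $$ (0, 0) \<noteq> - 1"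
  shows "rotatable m 1 A"
  unfolding rotatable_def Let_def using assms
  by (intro conjI allI first_col_norm2_1x1 carrier_matI) (simp_all add: pivot_def)

text \<open>A differentiable image of the line has measure zero in the plane. A polynomial
  approximation p therefore misses some value c of modulus below \<open>e / 2\<close>, and
  \<open>p - c\<close> has no zero; the other half of \<open>e\<close> pays for the
  approximation.\<close>

lemma nonvanishing_approximation:
  fixes g :: "real \<Rightarrow> complex"
  assumes g: "continuous_on {a..b} g" and e: "0 < e"
  obtains h where "continuous_on {a..b} h" "\<And>t. t \<in> {a..b} \<Longrightarrow> h t \<noteq> 0"
    "\<And>t. t \<in> {a..b} \<Longrightarrow> cmod (h t - g t) < e"
proof -
  obtain p where p: "polynomial_function p" "\<And>t. t \<in> {a..b} \<Longrightarrow> cmod (g t - p t) < e / 2"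
    using Stone_Weierstrass_polynomial_function[OF compact_Icc g, of "e / 2"] e by auto
  have "negligible (p ` {a..b})"
    by (rule negligible_differentiable_image_lowdim)
      (auto intro: differentiable_on_polynomial_function p)
  moreover have "\<not> negligible (ball (0::complex) (e / 2))"
    using e by (simp add: open_not_negligible)
  ultimately obtain c where c: "c \<in> ball 0 (e / 2)" "c \<notin> p ` {a..b}"
    using negligible_subset by blast
  show thesis
  proof
    show "continuous_on {a..b} (\<lambda>t. p t - c)"
      by (intro continuous_intros continuous_on_polymonial_function p)
    show "p t - c \<noteq> 0" if "t \<in> {a..b}" for t using c that by auto
    show "cmod (p t - c - g t) < e" if "t \<in> {a..b}" for t
    proof -
      have "cmod (p t - c - g t) \<le> cmod (g t - p t) + cmod c"
        using norm_triangle_ineq4[of "p t - g t" c] by (simp add: norm_minus_commute algebra_simps)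
      also have "\<dots> < e / 2 + e / 2" using p(2)[OF that] c(1) by (intro add_strict_mono) auto
      finally show ?thesis by simp
    qed
  qed
qed

section \<open>Loops in the unitary group\<close>

text \<open>The set of admissible starting points is a parameter because loops are treated with the
  identity as the only start, and restrictions of equivariant loops with the whole fixed
  group.\<close>

abbreviation half_homotopic ::
  "nat \<Rightarrow> complex mat set \<Rightarrow> (real \<Rightarrow> complex mat) \<Rightarrow> (real \<Rightarrow> complex mat) \<Rightarrow> bool" where
  "half_homotopic m K \<equiv>
     homotopic_with (\<lambda>f. f 0 \<in> K \<and> f pi = 1\<^sub>m m) (top_of_set {0..pi}) (unitary_topology m)"

lemma half_homotopic_iff:
  "half_homotopic m K f h \<longleftrightarrow>
    (\<exists>H. continuous_map (top_of_set ({0..1::real} \<times> {0..pi})) (unitary_topology m) H \<and>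
       (\<forall>t\<in>{0..pi}. H (0, t) = f t) \<and> (\<forall>t\<in>{0..pi}. H (1, t) = h t) \<and>
       (\<forall>s\<in>{0..1}. H (s, 0) \<in> K \<and> H (s, pi) = 1\<^sub>m m))"
  by (subst homotopic_with) (auto simp: prod_topology_subtopology_eu)

lemma half_homotopicI:
  assumes "continuous_map (top_of_set ({0..1::real} \<times> {0..pi})) (unitary_topology m) H"
    and "\<And>t. t \<in> {0..pi} \<Longrightarrow> H (0, t) = f t" "\<And>t. t \<in> {0..pi} \<Longrightarrow> H (1, t) = h t"
    and "\<And>s. s \<in> {0..1} \<Longrightarrow> H (s, 0) \<in> K" "\<And>s. s \<in> {0..1} \<Longrightarrow> H (s, pi) = 1\<^sub>m m"
  shows "half_homotopic m K f h"
  unfolding half_homotopic_iff by (intro exI[of _ H]) (use assms in blast)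

lemma continuous_map_unitary_snd:
  assumes "continuous_map (top_of_set T) (unitary_topology m) f"
  shows "continuous_map (top_of_set (S \<times> T)) (unitary_topology m) (\<lambda>z. f (snd z))"
proof -
  have "continuous_map (top_of_set (S \<times> T)) (top_of_set T) snd"
    by (auto simp: continuous_map_in_subtopology intro!: continuous_intros)
  from continuous_map_compose[OF this assms] show ?thesis by (simp add: o_def)
qed

lemma continuous_map_unitary_mult:
  assumes "continuous_map X (unitary_topology m) f" "continuous_map X (unitary_topology m) h"
  shows "continuous_map X (unitary_topology m) (\<lambda>x. f x * h x)"
  using assms unfolding continuous_map_unitary_topology
  by (auto intro: mat_continuous_mult unitary_group_mult)

text \<open>A column of a unitary matrix has norm 1, so an entry of modulus 1 leaves nothing for the
  others.\<close>

lemma unitary_first_entry_minus_1: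
  assumes A: "A \<in> unitary_group m" and m: "0 < m" and A0: "A $$ (0, 0) = - 1"
  shows "A * frame m 1 = - frame m 1"
proof -
  have m1: "0 < Suc 0" "Suc 0 \<le> m" using m by simp_all
  note V = isometry_mult_frame[OF A m1]
  let ?V = "A * frame m (Suc 0)"
  have "(\<Sum>i<m. (cmod (?V $$ (i, 0)))\<^sup>2) = 1"
    by (rule isometry_first_col[of _ _ "Suc 0"]) (use V in auto)
  then have "(\<Sum>i\<in>{..<m} - {0}. (cmod (?V $$ (i, 0)))\<^sup>2) = 0"
    using m V(3) A0 by (subst (asm) sum.remove[of _ 0]) auto
  then have z: "?V $$ (i, 0) = 0" if "i < m" "i \<noteq> 0" for i
    using that by (subst (asm) sum_nonneg_eq_0_iff) auto
  have "?V = - frame m (Suc 0)"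
  proof (rule eq_matI)
    fix i j assume "i < dim_row (- frame m (Suc 0))" "j < dim_col (- frame m (Suc 0))"
    then show "?V $$ (i, j) = (- frame m (Suc 0)) $$ (i, j)"
      using z[of i] V(3) A0 by (cases "i = 0") auto
  qed (use V(1) in auto)
  then show ?thesis by simp
qed

text \<open>The vector \<open>e_1\<close> tilted towards \<open>e_2\<close>. Its first entry is a
  nonnegative real, so it is never \<open>- e_1\<close> and the rotating family is defined on
  it.\<close>

definition unit_col :: "nat \<Rightarrow> complex \<Rightarrow> complex mat" where
  "unit_col m z = Matrix.mat m 1
     (\<lambda>(i, j). if i = 0 then complex_of_real (sqrt (1 - (cmod z)\<^sup>2)) else if i = 1 then z else 0)"

lemma unit_col:
  assumes m: "2 \<le> m" and z: "cmod z \<le> 1"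
  shows "unit_col m z \<in> carrier_mat m 1" "adj (unit_col m z) * unit_col m z = 1\<^sub>m 1"
    "unit_col m z $$ (0, 0) = complex_of_real (sqrt (1 - (cmod z)\<^sup>2))"
    "unit_col m z $$ (1, 0) = z" "unit_col m z $$ (0, 0) \<noteq> - 1"
proof -
  obtain n where n: "m = Suc (Suc n)" using that[of "m - 2"] m by simp
  show car: "unit_col m z \<in> carrier_mat m 1" by (auto simp: unit_col_def)
  show 00: "unit_col m z $$ (0, 0) = complex_of_real (sqrt (1 - (cmod z)\<^sup>2))"
    and 10: "unit_col m z $$ (1, 0) = z"
    using m by (auto simp: unit_col_def)
  have z1: "(cmod z)\<^sup>2 \<le> 1" using z by (simp add: abs_square_le_1)
  have "(\<Sum>i<m. (cmod (unit_col m z $$ (i, 0)))\<^sup>2) = 1"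
    using z1 unfolding n by (simp add: sum.lessThan_Suc_shift unit_col_def del: sum.lessThan_Suc)
  then have "(adj (unit_col m z) * unit_col m z) $$ (0, 0) = 1"
    using adj_mult_self_index_0[OF car] by simp
  then show "adj (unit_col m z) * unit_col m z = 1\<^sub>m 1"
    using car by (intro eq_matI) (auto simp del: index_mult_mat(1))
  show "unit_col m z $$ (0, 0) \<noteq> - 1"
  proof
    assume "unit_col m z $$ (0, 0) = - 1"
    then have "sqrt (1 - (cmod z)\<^sup>2) = - 1"
      unfolding 00 by (metis of_real_1 of_real_eq_iff of_real_minus)
    with z1 show False by (smt (verit) real_sqrt_ge_zero)
  qed
qed

lemma unit_col_zero: "2 \<le> m \<Longrightarrow> unit_col m 0 = frame m 1"
  by (rule eq_matI) (auto simp: unit_col_def)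

text \<open>The rotation taking a slightly perturbed basis vector \<open>p(t)\<close> back to \<open>e\<^sub>1\<close> is
  null-homotopic; \<open>p(t)\<close> is chosen to miss the negative of the first column of \<open>f(t)\<close>.\<close>

lemma loop_avoids_minus_1:
  assumes m: "2 \<le> m"
    and f: "continuous_map (top_of_set {0..pi}) (unitary_topology m) f"
    and f0: "f 0 = 1\<^sub>m m" and fpi: "f pi = 1\<^sub>m m"
  obtains h where "half_homotopic m {1\<^sub>m m} f h" "\<And>t. t \<in> {0..pi} \<Longrightarrow> h t $$ (0, 0) \<noteq> - 1"
proof -
  have fc: "continuous_on {0..pi} (\<lambda>t. f t $$ (i, j))" if "i < m" "j < m" for i j
    using mat_continuousD(2)[OF _ that] f unfolding continuous_map_unitary_topology by fastforce
  have fU: "f t \<in> unitary_group m" if "t \<in> {0..pi}" for t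
    using f that unfolding continuous_map_unitary_topology by auto
  obtain N where N: "continuous_on {0..pi} N" "\<And>t. t \<in> {0..pi} \<Longrightarrow> N t \<noteq> 0"
    "\<And>t. t \<in> {0..pi} \<Longrightarrow> cmod (N t - f t $$ (1, 0)) < 1/2"
    by (rule nonvanishing_approximation[OF fc[of 1 0], of "1/2"]) (use m in auto)
  \<comment> \<open>A cutoff that is 1 where the real part of the corner entry is at most -1/2 and 0
    where it is nonnegative. In particular it vanishes at both ends, where \<open>f\<close> is the
    identity, so the perturbation fixes them.\<close>
  define c where "c t = max 0 (min 1 (- 2 * Re (f t $$ (0, 0))))" for t
  \<comment> \<open>Chosen such that, where the cutoff is 1, the second entry of the column of
    \<open>f t\<close> can be \<open>- z t\<close> only if \<open>N t = 0\<close>.\<close>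
  define z where "z t = complex_of_real (c t) * (N t - f t $$ (1, 0))" for t
  have c01: "0 \<le> c t" "c t \<le> 1" for t by (auto simp: c_def)
  have z_le: "cmod (z t) \<le> 1/2" if "t \<in> {0..pi}" for t
  proof -
    have "cmod (z t) = c t * cmod (N t - f t $$ (1, 0))" by (simp add: z_def norm_mult c01)
    also have "\<dots> \<le> cmod (N t - f t $$ (1, 0))"
      using c01 by (intro mult_left_le_one_le) auto
    finally show ?thesis using N(3)[OF that] by linarith
  qed
  have zc: "continuous_on {0..pi} z"
    unfolding z_def c_def using m by (intro continuous_intros N fc) auto
  have z_end: "z 0 = 0" "z pi = 0" using m by (auto simp: z_def c_def f0 fpi)
  let ?p = "\<lambda>t. unit_col m (z t)"
  let ?X = "top_of_set ({0..1::real} \<times> {0..pi})"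
  have p: "?p t \<in> carrier_mat m 1" "adj (?p t) * ?p t = 1\<^sub>m 1"
     "?p t $$ (0, 0) = complex_of_real (sqrt (1 - (cmod (z t))\<^sup>2))" "?p t $$ (1, 0) = z t"
     "?p t $$ (0, 0) \<noteq> - 1"
    if "t \<in> {0..pi}" for t
    using unit_col[OF m, of "z t"] z_le[OF that] by auto
  have piv: "adj (pivot m 1 s (?p t)) * pivot m 1 s (?p t)
      = complex_of_real (first_col_norm2 (pivot m 1 s (?p t))) \<cdot>\<^sub>m 1\<^sub>m 1" if "t \<in> {0..pi}" for s t
    by (rule first_col_norm2_1x1, rule carrier_matI) (use p[OF that] in auto)
  have RU: "householder m 1 s (?p t) \<in> unitary_group m" if "t \<in> {0..pi}" "0 \<le> s" "s \<le> 1" for s t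
    using m that by (intro householder_unitary p piv) auto
  define H where "H = (\<lambda>(s, t). householder m 1 s (?p t) * f t)"
  define h where "h t = H (1, t)" for t
  have "mat_continuous ?X m m (\<lambda>x. householder m 1 (fst x) (?p (snd x)))"
  proof (rule mat_continuous_householder)
    show "mat_continuous ?X m 1 (\<lambda>x. ?p (snd x))"
    proof (rule mat_continuousI)
      fix i j :: nat assume ij: "i < m" "j < 1"
      have "continuous_on ({0..1::real} \<times> {0..pi}) (\<lambda>x::real\<times>real. z (snd x))"
        by (rule continuous_on_compose2[OF zc]) (auto intro: continuous_intros)
      then show "continuous_map ?X euclidean (\<lambda>x. ?p (snd x) $$ (i, j))"
        using ij by (cases "i = 0"; cases "i = 1") (auto simp: unit_col_def intro!: continuous_intros)
    qed (auto simp: unit_col_def)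
    fix x :: "real \<times> real" assume "x \<in> topspace ?X"
    then have x: "0 \<le> fst x" "fst x \<le> 1" "snd x \<in> {0..pi}" by auto
    have "0 < first_col_norm2 (pivot m 1 (fst x) (?p (snd x)))"
      using m x by (intro pivot_norm_pos p) auto
    then show "first_col_norm2 (pivot m 1 (fst x) (?p (snd x))) \<noteq> 0" by simp
  qed (auto intro!: continuous_intros)
  then have "continuous_map ?X (unitary_topology m) (\<lambda>x. householder m 1 (fst x) (?p (snd x)))"
    unfolding continuous_map_unitary_topology using RU by auto
  then have Hc: "continuous_map ?X (unitary_topology m) H"
    unfolding H_def case_prod_beta
    by (rule continuous_map_unitary_mult[OF _ continuous_map_unitary_snd[OF f]])
  have hom: "half_homotopic m {1\<^sub>m m} f h"
  proof (rule half_homotopicI[OF Hc])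
    fix t assume t: "t \<in> {0..pi}"
    show "H (0, t) = f t"
      using unitary_groupD(1)[OF fU[OF t]] householder_zero[OF p(1)[OF t]] m by (simp add: H_def)
  next
    fix s :: real assume s: "s \<in> {0..1}"
    have "householder m 1 s (frame m 1) = 1\<^sub>m m" using s m by (intro householder_frame) auto
    then show "H (s, 0) \<in> {1\<^sub>m m}" "H (s, pi) = 1\<^sub>m m"
      using unit_col_zero[OF m] by (simp_all add: H_def z_end f0 fpi)
  qed (simp add: h_def)
  moreover have "h t $$ (0, 0) \<noteq> - 1" if t: "t \<in> {0..pi}" for t
  proof
    assume h0: "h t $$ (0, 0) = - 1"
    define R where "R = householder m 1 1 (?p t)"
    let ?E = "frame m 1"
    have R: "R \<in> unitary_group m" unfolding R_def using RU[OF t] by simp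
    note RD = unitary_groupD[OF R] and fD = unitary_groupD[OF fU[OF t]]
    note [simp] = carrier_matD[OF RD(1)] carrier_matD[OF fD(1)] carrier_matD[OF p(1)[OF t]]
    \<comment> \<open>At a bad time \<open>R * f t\<close> sends \<open>e_1\<close> to
      \<open>- e_1\<close>, while \<open>R\<close> sends the tilted vector to \<open>e_1\<close>.
      Cancelling \<open>R\<close> shows that the first column of \<open>f t\<close> is the negative
      of the tilted vector.\<close>
    have "h t * ?E = - ?E"
      using h0 m R fU[OF t] unfolding h_def H_def case_prod_conv R_def[symmetric]
      by (intro unitary_first_entry_minus_1) (auto intro: unitary_group_mult)
    moreover have "R * ?p t = ?E"
      unfolding R_def
      using m by (intro householder_one p piv t) auto
    ultimately have "R * (f t * ?E) = - (R * ?p t)"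
      unfolding h_def H_def case_prod_conv R_def[symmetric] by (simp add: mat_mult_assoc)
    then have "adj R * (R * (f t * ?E)) = adj R * (- (R * ?p t))" by simp
    also have "\<dots> = - (adj R * (R * ?p t))"
      using uminus_mult_right_mat[of "adj R" "R * ?p t"] by simp
    finally have "(adj R * R) * (f t * ?E) = - ((adj R * R) * ?p t)"
      by (simp add: mat_mult_assoc)
    then have fE: "f t * ?E = - ?p t" by (simp add: RD(2))
    have ent: "f t $$ (i, 0) = - (?p t $$ (i, 0))" if "i < m" for i
      using mult_frame_index[OF fD(1), of 1 i 0] m that unfolding fE by simp
    \<comment> \<open>The bound 1/2 on \<open>z\<close> keeps the first entry of the tilted vector
      at least 1/2, so a bad time lies in the range where the cutoff is 1.\<close>
    have "1/2 \<le> sqrt (1 - (cmod (z t))\<^sup>2)"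
    proof (rule real_le_rsqrt)
      have "(cmod (z t))\<^sup>2 \<le> (1/2)\<^sup>2" using z_le[OF t] by (intro power_mono) auto
      then show "(1/2)\<^sup>2 \<le> 1 - (cmod (z t))\<^sup>2" by (simp add: power2_eq_square)
    qed
    then have "c t = 1" using ent[of 0] m p(3)[OF t] by (simp add: c_def)
    moreover have "f t $$ (1, 0) = - z t" using ent[of 1] m p(4)[OF t] by simp
    ultimately have "N t = 0" by (simp add: z_def)
    with N(2)[OF t] show False by simp
  qed
  ultimately show thesis using that by blast
qed

definition last_diag :: "nat \<Rightarrow> complex \<Rightarrow> complex mat" where
  "last_diag m z = Matrix.mat m m (\<lambda>(i, j). if i = j then if Suc i = m then z else 1 else 0)"

lemma last_diag_dim [simp]: "dim_row (last_diag m z) = m" "dim_col (last_diag m z) = m"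
  by (auto simp: last_diag_def)

text \<open>\<open>block\<close> puts ones in front, which is why the variable entry sits in the
  last place: the normal form is then stable under the induction on the size.\<close>

lemma block_last_diag: "0 < n \<Longrightarrow> block k (last_diag n z) = last_diag (k + n) z"
proof (rule eq_matI)
  fix i j assume "0 < n" "i < dim_row (last_diag (k + n) z)" "j < dim_col (last_diag (k + n) z)"
  then show "block k (last_diag n z) $$ (i, j) = last_diag (k + n) z $$ (i, j)"
    by (cases "i < k"; cases "j < k"; cases "i = j") (simp_all add: block_index last_diag_def, arith+)
qed auto

lemma last_diag_one [simp]: "last_diag m 1 = 1\<^sub>m m"
  by (rule eq_matI) (auto simp: last_diag_def)

text \<open>Induction on the size. A loop of \<open>1 \<times> 1\<close> matrices is already its own
  normal form; otherwise the loop is deformed to \<open>block 1 b\<close>, and the deformation of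
  \<open>b\<close> given by the induction hypothesis is carried over by the continuous map
  \<open>block 1\<close>.\<close>

lemma half_homotopic_loop_last_diag:
  assumes "0 < m" "continuous_map (top_of_set {0..pi}) (unitary_topology m) f"
    "f 0 = 1\<^sub>m m" "f pi = 1\<^sub>m m"
  shows "\<exists>\<delta>. continuous_on {0..pi} \<delta> \<and> (\<forall>t\<in>{0..pi}. cmod (\<delta> t) = 1) \<and> \<delta> 0 = 1 \<and> \<delta> pi = 1 \<and>
     half_homotopic m {1\<^sub>m m} f (\<lambda>t. last_diag m (\<delta> t))"
  using assms
proof (induction m arbitrary: f)
  case (Suc n)
  note f = Suc.prems(2-4)
  show ?case
  proof (cases "n = 0")
    case True
    have fc: "continuous_on {0..pi} (\<lambda>t. f t $$ (0, 0))"
      using mat_continuousD(2)[of "top_of_set {0..pi}" "Suc n" "Suc n" f 0 0] f(1)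
      unfolding continuous_map_unitary_topology by simp
    have fU: "f t \<in> unitary_group (Suc n)" if "t \<in> {0..pi}" for t
      using f(1) that unfolding continuous_map_unitary_topology by auto
    have "cmod (f t $$ (0, 0)) = 1" if "t \<in> {0..pi}" for t
      using isometry_first_col[of "f t" 1 1] unitary_groupD[OF fU[OF that]] True
      by (simp add: power2_eq_1_iff) (smt (verit) norm_ge_zero)
    moreover have ld: "f t = last_diag (Suc n) (f t $$ (0, 0))" if "t \<in> {0..pi}" for t
      using unitary_groupD(1)[OF fU[OF that]] True by (intro eq_matI) (auto simp: last_diag_def)
    then have "half_homotopic (Suc n) {1\<^sub>m (Suc n)} f (\<lambda>t. last_diag (Suc n) (f t $$ (0, 0)))"
      using f by (intro homotopic_with_equal) auto
    ultimately show ?thesis using fc f by (intro exI[of _ "\<lambda>t. f t $$ (0, 0)"]) auto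
  next
    case False
    let ?m = "1 + n"
    have m: "2 \<le> ?m" "Suc n = ?m" using False by auto
    note f = f[unfolded m(2)]
    obtain h where h: "half_homotopic ?m {1\<^sub>m ?m} f h" "\<And>t. t \<in> {0..pi} \<Longrightarrow> h t $$ (0, 0) \<noteq> - 1"
      by (rule loop_avoids_minus_1[OF m(1) f]) blast
    have hc: "continuous_map (top_of_set {0..pi}) (unitary_topology ?m) h"
      and h0: "h 0 = 1\<^sub>m ?m" and hpi: "h pi = 1\<^sub>m ?m"
      using homotopic_with_imp_continuous_maps[OF h(1)] homotopic_with_imp_property[OF h(1)] by auto
    have hU: "h t \<in> unitary_group ?m" if "t \<in> {0..pi}" for t
      using hc that unfolding continuous_map_unitary_topology by auto
    have rot: "rotatable ?m 1 (h t)" if "t \<in> {0..pi}" for t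
      using unitary_groupD(1)[OF hU[OF that]] h(2)[OF that] by (rule rotatable_1)
    let ?X = "top_of_set ({0..1::real} \<times> {0..pi})"
    define H where "H = (\<lambda>x. rotation ?m 1 (fst x) (h (snd x)) * h (snd x))"
    define b where "b t = lower_block 1 (H (1, t))" for t
    have Hc: "continuous_map ?X (unitary_topology ?m) H"
      unfolding H_def using rot
      by (intro continuous_map_rotation continuous_map_unitary_snd hc)
        (auto intro!: continuous_intros)
    have H1: "H (1, t) = block 1 (b t)" "b t \<in> unitary_group n" if "t \<in> {0..pi}" for t
      using rotation_one[OF hU[OF that] _ rot[OF that]] unfolding b_def H_def by auto
    have hom1: "half_homotopic ?m {1\<^sub>m ?m} h (\<lambda>t. block 1 (b t))"
    proof (rule half_homotopicI[OF Hc])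
      fix t assume t: "t \<in> {0..pi}"
      show "H (0, t) = h t"
        using rotation_zero[OF hU[OF t], of 1] unitary_groupD(1)[OF hU[OF t]] by (simp add: H_def)
    next
      fix s :: real assume "s \<in> {0..1}"
      then have "rotation ?m 1 s (1\<^sub>m ?m) = 1\<^sub>m ?m" by (intro rotation_one_mat) auto
      then show "H (s, 0) \<in> {1\<^sub>m ?m}" "H (s, pi) = 1\<^sub>m ?m"
        by (simp_all add: H_def h0 hpi)
    qed (use H1 in auto)
    have "continuous_map (top_of_set {0..pi}) ?X (Pair 1)"
      by (auto simp: continuous_map_in_subtopology intro!: continuous_intros)
    then have "continuous_map (top_of_set {0..pi}) (unitary_topology ?m) (H \<circ> Pair 1)"
      using Hc continuous_map_compose by blast
    then have "mat_continuous (top_of_set {0..pi}) n n b"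
      unfolding b_def continuous_map_unitary_topology o_def
      by (intro mat_continuous_lower_block) auto
    then have bc: "continuous_map (top_of_set {0..pi}) (unitary_topology n) b"
      unfolding continuous_map_unitary_topology using H1 by auto
    have "block 1 (b 0) = 1\<^sub>m ?m" "block 1 (b pi) = 1\<^sub>m ?m"
      using homotopic_with_imp_property[OF hom1] by auto
    then have "lower_block 1 (block 1 (b 0)) = lower_block 1 (block 1 (1\<^sub>m n))"
      "lower_block 1 (block 1 (b pi)) = lower_block 1 (block 1 (1\<^sub>m n))"
      by (simp_all only: block_one)
    then have b1: "b 0 = 1\<^sub>m n" "b pi = 1\<^sub>m n" by simp_all
    obtain \<delta> where \<delta>: "continuous_on {0..pi} \<delta>" "\<forall>t\<in>{0..pi}. cmod (\<delta> t) = 1" "\<delta> 0 = 1" "\<delta> pi = 1"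
      and hom2: "half_homotopic n {1\<^sub>m n} b (\<lambda>t. last_diag n (\<delta> t))"
      using Suc.IH[OF _ bc b1] False by auto
    have "half_homotopic ?m {1\<^sub>m ?m} (block 1 \<circ> b) (block 1 \<circ> (\<lambda>t. last_diag n (\<delta> t)))"
      by (rule homotopic_with_compose_continuous_map_left[OF hom2 continuous_map_block])
        (auto simp: block_one)
    then have "half_homotopic ?m {1\<^sub>m ?m} (\<lambda>t. block 1 (b t)) (\<lambda>t. last_diag ?m (\<delta> t))"
      using False by (simp add: o_def block_last_diag)
    then have "half_homotopic ?m {1\<^sub>m ?m} f (\<lambda>t. last_diag ?m (\<delta> t))"
      using homotopic_with_trans[OF homotopic_with_trans[OF h(1) hom1]] by blast
    with \<delta> show ?thesis unfolding m(2) by blast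
  qed
qed simp

section \<open>Classification by half turns\<close>

lemma det_map_cnj:
  assumes "A \<in> carrier_mat m m"
  shows "det (map_mat cnj A) = cnj (det A)"
proof -
  interpret comm_ring_hom cnj by unfold_locales auto
  show ?thesis using assms by (simp add: hom_det)
qed

lemma adj_eq_transpose: "adj A = map_mat cnj (transpose_mat A)"
  by (rule eq_matI) auto

lemma det_adj: "A \<in> carrier_mat m m \<Longrightarrow> det (adj A) = cnj (det A)"
  unfolding adj_eq_transpose by (subst det_map_cnj[of _ m]) (auto simp: det_transpose)

lemma cmod_det_unitary:
  assumes "A \<in> unitary_group m"
  shows "cmod (det A) = 1"
proof -
  note A = unitary_groupD[OF assms]
  have "cnj (det A) * det A = 1"
    using det_mult[OF adj_carrier[OF A(1)] A(1)] A by (simp add: det_adj)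
  then have "complex_of_real ((cmod (det A))\<^sup>2) = 1"
    by (metis complex_norm_square mult.commute)
  then show ?thesis by (metis abs_norm_cancel of_real_eq_1_iff power2_eq_1_iff power_one real_sqrt_abs real_sqrt_one)
qed

lemma det_last_diag:
  assumes "0 < m"
  shows "det (last_diag m z) = z"
proof -
  obtain n where n: "m = Suc n" using assms by (metis Suc_pred)
  have "det (last_diag m z) = (\<Prod>i = 0..<m. last_diag m z $$ (i, i))"
    by (subst det_upper_triangular[of _ m]) (auto simp: last_diag_def prod_list_diag_prod intro: carrier_matI)
  also have "\<dots> = (\<Prod>i = 0..<n. 1) * z"
    unfolding n prod.atLeast0_lessThan_Suc by (intro arg_cong2[of _ _ _ _ "(*)"] prod.cong) (auto simp: last_diag_def)
  finally show ?thesis by simp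
qed

lemma last_diag_mult: "last_diag m a * last_diag m b = last_diag m (a * b)"
proof (rule eq_matI)
  fix i j assume "i < dim_row (last_diag m (a * b))" "j < dim_col (last_diag m (a * b))"
  then have ij: "i < m" "j < m" by auto
  have "(last_diag m a * last_diag m b) $$ (i, j)
      = (\<Sum>l\<in>{0..<m}. last_diag m a $$ (i, l) * last_diag m b $$ (l, j))"
    using ij by (simp add: scalar_prod_def)
  also have "\<dots> = (\<Sum>l\<in>{0..<m}. if l = i then last_diag m (a * b) $$ (i, j) else 0)"
    using ij by (intro sum.cong) (auto simp: last_diag_def)
  finally show "(last_diag m a * last_diag m b) $$ (i, j) = last_diag m (a * b) $$ (i, j)"
    using ij by simp
qed auto

lemma last_diag_unitary:
  assumes "cmod z = 1"
  shows "last_diag m z \<in> unitary_group m"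
proof (rule unitary_groupI)
  have "adj (last_diag m z) = last_diag m (cnj z)"
    by (rule eq_matI) (auto simp: last_diag_def)
  moreover have "cnj z * z = 1"
    using assms by (metis complex_norm_square mult.commute of_real_1 power_one)
  ultimately show "adj (last_diag m z) * last_diag m z = 1\<^sub>m m"
    by (simp add: last_diag_mult)
qed (simp add: carrier_matI)

lemma continuous_map_last_diag:
  assumes "continuous_map X euclidean z" "\<And>x. x \<in> topspace X \<Longrightarrow> cmod (z x) = 1"
  shows "continuous_map X (unitary_topology m) (\<lambda>x. last_diag m (z x))"
  unfolding continuous_map_unitary_topology
proof (intro conjI ballI mat_continuousI)
  fix i j assume "i < m" "j < m"
  then show "continuous_map X euclidean (\<lambda>x. last_diag m (z x) $$ (i, j))"
    using assms(1) by (cases "i = j"; cases "Suc i = m") (auto simp: last_diag_def)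
qed (auto intro: last_diag_unitary carrier_matI assms)

text \<open>The values lie in the multiples of i pi, which are at distance at least pi from each
  other, and the interval is connected. The factor 2 admits differences of logarithms of 1 and
  -1.\<close>

lemma constant_if_exp_double_1:
  fixes q :: "real \<Rightarrow> complex"
  assumes q: "continuous_on {a..b} q" and e: "\<And>x. x \<in> {a..b} \<Longrightarrow> exp (2 * q x) = 1" and ab: "a \<le> b"
  shows "q a = q b"
proof -
  have "q constant_on {a..b}"
  proof (rule continuous_discrete_range_constant[OF _ q])
    fix x assume x: "x \<in> {a..b}"
    have "pi \<le> cmod (q y - q x)" if "y \<in> {a..b}" "q y \<noteq> q x" for y
    proof -
      have "exp (2 * (q y - q x)) = 1"
        using e[OF x] e[OF that(1)] by (simp add: right_diff_distrib exp_diff)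
      then obtain n :: int where n: "Re (2 * (q y - q x)) = 0" "Im (2 * (q y - q x)) = of_int (2 * n) * pi"
        unfolding exp_eq_1 by blast
      then have eq: "q y - q x = Complex 0 (of_int n * pi)"
        by (intro complex_eqI) auto
      then have "n \<noteq> 0" using that(2) by (auto simp: complex_eq_iff)
      then have "1 \<le> \<bar>of_int n :: real\<bar>" by linarith
      then show ?thesis unfolding eq by (simp add: complex_norm abs_mult)
    qed
    then show "\<exists>e>0. \<forall>y. y \<in> {a..b} \<and> q y \<noteq> q x \<longrightarrow> e \<le> norm (q y - q x)"
      using pi_gt_zero by blast
  qed simp
  then show ?thesis using ab unfolding constant_on_def by auto
qed

text \<open>A relation rather than a function, since the logarithm is not unique. The difference is
  start minus end because the model paths run backwards, with angle \<open>n (pi - t)\<close>; this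
  gives \<open>model m n\<close> the degree \<open>n\<close>.\<close>

definition has_half_degree :: "(real \<Rightarrow> complex mat) \<Rightarrow> int \<Rightarrow> bool" where
  "has_half_degree f n \<longleftrightarrow> (\<exists>g. continuous_on {0..pi} g \<and> (\<forall>t\<in>{0..pi}. det (f t) = exp (g t)) \<and>
     g 0 - g pi = \<i> * of_real pi * of_int n)"

text \<open>Two logarithms of the same function differ by a continuous function with values in a
  discrete set, hence by a constant, which drops out of the difference of the end values.\<close>

lemma has_half_degree_unique:
  assumes "has_half_degree f n" "has_half_degree f n'"
  shows "n = n'"
proof -
  obtain g where g: "continuous_on {0..pi} g" "\<And>t. t\<in>{0..pi} \<Longrightarrow> det (f t) = exp (g t)"
     "g 0 - g pi = \<i> * of_real pi * of_int n"
    using assms(1) unfolding has_half_degree_def by blast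
  obtain g' where g': "continuous_on {0..pi} g'" "\<And>t. t\<in>{0..pi} \<Longrightarrow> det (f t) = exp (g' t)"
     "g' 0 - g' pi = \<i> * of_real pi * of_int n'"
    using assms(2) unfolding has_half_degree_def by blast
  have "g 0 - g' 0 = g pi - g' pi"
  proof (rule constant_if_exp_double_1[where q = "\<lambda>t. g t - g' t"])
    show "continuous_on {0..pi} (\<lambda>t. g t - g' t)" using g g' by (intro continuous_intros)
    fix t assume t: "t \<in> {0..pi}"
    have "exp (g t - g' t) = 1" using g(2)[OF t] g'(2)[OF t] by (simp add: exp_diff)
    then show "exp (2 * (g t - g' t)) = 1" unfolding exp_double by simp
  qed simp
  then have "g 0 - g pi = g' 0 - g' pi" by (simp add: algebra_simps)
  then show ?thesis unfolding g(3) g'(3) by simp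
qed

text \<open>Pointwise multiplication by a path shifts the admissible starting points. It turns a
  homotopy of loops into one of paths that start elsewhere in the fixed group.\<close>

lemma half_homotopic_mult_right:
  assumes hom: "half_homotopic m K f h" and d: "continuous_map (top_of_set {0..pi}) (unitary_topology m) d"
    and K: "\<And>A. A \<in> K \<Longrightarrow> A * d 0 \<in> L" and dpi: "d pi = 1\<^sub>m m"
  shows "half_homotopic m L (\<lambda>t. f t * d t) (\<lambda>t. h t * d t)"
proof -
  obtain H where H: "continuous_map (top_of_set ({0..1::real} \<times> {0..pi})) (unitary_topology m) H"
    "\<And>t. t\<in>{0..pi} \<Longrightarrow> H (0, t) = f t" "\<And>t. t\<in>{0..pi} \<Longrightarrow> H (1, t) = h t"
    "\<And>s. s\<in>{0..1} \<Longrightarrow> H (s, 0) \<in> K \<and> H (s, pi) = 1\<^sub>m m"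
    using hom unfolding half_homotopic_iff by blast
  show ?thesis
    by (rule half_homotopicI[of _ "\<lambda>z. H z * d (snd z)"])
      (use H K dpi in \<open>auto intro: continuous_map_unitary_mult continuous_map_unitary_snd[OF d]\<close>)
qed

text \<open>A logarithm exists because the interval is contractible; its real part vanishes since
  the modulus is 1, and subtracting the value at \<open>pi\<close> normalises the angle.\<close>

lemma continuous_cis_lift:
  assumes "continuous_on {0..pi} \<delta>" "\<And>t. t \<in> {0..pi} \<Longrightarrow> cmod (\<delta> t) = 1" "\<delta> pi = 1"
  obtains \<theta> where "continuous_on {0..pi} \<theta>" "\<And>t. t \<in> {0..pi} \<Longrightarrow> \<delta> t = cis (\<theta> t)" "\<theta> pi = 0"
proof -
  obtain g where g: "continuous_on {0..pi} g" "\<And>t. t \<in> {0..pi} \<Longrightarrow> \<delta> t = exp (g t)"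
  proof (rule continuous_logarithm_on_contractible[OF assms(1)])
    show "contractible {0..pi}" by (intro convex_imp_contractible) simp
    show "\<delta> z \<noteq> 0" if "z \<in> {0..pi}" for z using assms(2)[OF that] by auto
  qed blast
  have cis: "\<delta> t = cis (Im (g t))" if "t \<in> {0..pi}" for t
  proof -
    have "exp (Re (g t)) = 1" using assms(2)[OF that] unfolding g(2)[OF that] by simp
    then show ?thesis unfolding g(2)[OF that] by (simp add: exp_eq_polar)
  qed
  show thesis
  proof
    show "continuous_on {0..pi} (\<lambda>t. Im (g t) - Im (g pi))" by (intro continuous_intros g)
    have "cis (Im (g pi)) = 1" using cis[of pi] assms(3) by simp
    then show "\<delta> t = cis (Im (g t) - Im (g pi))" if "t \<in> {0..pi}" for t
      using cis[OF that] by (simp flip: cis_divide)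
  qed simp
qed

definition model :: "nat \<Rightarrow> int \<Rightarrow> real \<Rightarrow> complex mat" where
  "model m n t = last_diag m (cis (of_int n * (pi - t)))"

lemma continuous_map_model: "continuous_map (top_of_set S) (unitary_topology m) (model m n)"
  unfolding model_def by (rule continuous_map_last_diag) (auto intro!: continuous_intros)

lemma model_dim [simp]: "dim_row (model m n t) = m" "dim_col (model m n t) = m"
  by (auto simp: model_def)

lemma model_pi: "model m n pi = 1\<^sub>m m"
  by (simp add: model_def)

lemma cis_int_pi: "cis (of_int n * pi) = (if even n then 1 else - 1)"
proof (cases "even n")
  case True
  then obtain j where "n = 2 * j" by blast
  then have "cis (of_int n * pi) = cis (2 * pi * of_int j)" by (simp add: mult_ac)
  then show ?thesis using True by (simp add: cis_multiple_2pi)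
next
  case False
  then obtain j where j: "n = 2 * j + 1" by (metis oddE)
  have "cis (of_int n * pi) = cis (2 * pi * of_int j + pi)" unfolding j by (simp add: algebra_simps)
  also have "\<dots> = cis (2 * pi * of_int j) * cis pi" by (simp only: cis_mult)
  finally show ?thesis using False by (simp add: cis_multiple_2pi)
qed

lemma model_0: "model m n 0 = last_diag m (if even n then 1 else - 1)"
  by (simp only: model_def diff_zero cis_int_pi)

lemma has_half_degree_model:
  assumes "0 < m"
  shows "has_half_degree (model m n) n"
  unfolding has_half_degree_def
proof (intro exI[of _ "\<lambda>t. \<i> * of_real (of_int n * (pi - t))"] conjI ballI)
  show "det (model m n t) = exp (\<i> * of_real (of_int n * (pi - t)))" for t
    using assms by (simp add: model_def det_last_diag cis_conv_exp)
qed (auto intro!: continuous_intros)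

text \<open>What the two classes have in common. Conjugation of the determinant makes the invariant
  an integer; \<open>fixed_component\<close> is the information about the fixed group. It does not
  decide whether \<open>last_diag m (- 1)\<close> itself is fixed, and that decides which degrees
  occur.\<close>

locale unitary_involution =
  fixes m :: nat and G :: "complex mat \<Rightarrow> complex mat"
  assumes m_pos: "0 < m"
    and G_cont: "continuous_map (unitary_topology m) (unitary_topology m) G"
    and G_invol: "\<And>A. A \<in> unitary_group m \<Longrightarrow> G (G A) = A"
    and G_one: "G (1\<^sub>m m) = 1\<^sub>m m"
    and G_det: "\<And>A. A \<in> unitary_group m \<Longrightarrow> det (G A) = cnj (det A)"
    and fixed_component: "\<And>A. \<lbrakk>A \<in> unitary_group m; G A = A\<rbrakk> \<Longrightarrow>
      \<exists>B\<in>{1\<^sub>m m, last_diag m (- 1)}.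
        path_component_of (subtopology (unitary_topology m) {A. G A = A}) A B"
begin

abbreviation K :: "complex mat set" where "K \<equiv> {A. G A = A}"

lemma det_fixed:
  assumes "A \<in> unitary_group m" "A \<in> K"
  shows "(det A)\<^sup>2 = 1"
proof -
  have "det A = cnj (det A)" using G_det[OF assms(1)] assms(2) by simp
  then have "(det A)\<^sup>2 = complex_of_real ((cmod (det A))\<^sup>2)"
    by (metis complex_norm_square power2_eq_square)
  then show ?thesis using cmod_det_unitary[OF assms(1)] by simp
qed

text \<open>The determinant of the homotopy has a logarithm on the whole rectangle. Its two vertical
  edges carry determinants of square 1, so the difference of the logarithm between them is a
  continuous function of the homotopy parameter with values in the multiples of i pi, hence
  constant.\<close>

lemma half_homotopic_degree:
  assumes hom: "half_homotopic m K f h" and n: "has_half_degree f n"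
  shows "has_half_degree h n"
proof -
  let ?S = "{0..1::real} \<times> {0..pi}"
  obtain H where H: "continuous_map (top_of_set ?S) (unitary_topology m) H"
    "\<And>t. t\<in>{0..pi} \<Longrightarrow> H (0, t) = f t" "\<And>t. t\<in>{0..pi} \<Longrightarrow> H (1, t) = h t"
    "\<And>s. s\<in>{0..1} \<Longrightarrow> H (s, 0) \<in> K \<and> H (s, pi) = 1\<^sub>m m"
    using hom unfolding half_homotopic_iff by blast
  have HU: "H x \<in> unitary_group m" if "x \<in> ?S" for x
    using H(1) that unfolding continuous_map_unitary_topology by auto
  have dc: "continuous_on ?S (\<lambda>x. det (H x))"
    using H(1) mat_continuous_det unfolding continuous_map_unitary_topology by fastforce
  obtain g where g: "continuous_on ?S g" "\<And>x. x \<in> ?S \<Longrightarrow> det (H x) = exp (g x)"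
  proof (rule continuous_logarithm_on_contractible[OF dc])
    show "contractible ?S" by (intro convex_imp_contractible convex_Times) simp_all
    show "det (H x) \<noteq> 0" if "x \<in> ?S" for x using cmod_det_unitary[OF HU[OF that]] by auto
  qed blast
  have gt: "continuous_on {0..pi} (\<lambda>t. g (s, t))" if "s \<in> {0..1}" for s
    by (rule continuous_on_compose2[OF g(1)]) (use that in \<open>auto intro!: continuous_intros\<close>)
  have gs: "continuous_on {0..1} (\<lambda>s. g (s, t))" if "t \<in> {0..pi}" for t
    by (rule continuous_on_compose2[OF g(1)]) (use that in \<open>auto intro!: continuous_intros\<close>)
  have "g (0, 0) - g (0, pi) = g (1, 0) - g (1, pi)"
  proof (rule constant_if_exp_double_1[where q = "\<lambda>s. g (s, 0) - g (s, pi)"])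
    show "continuous_on {0..1} (\<lambda>s. g (s, 0) - g (s, pi))" by (intro continuous_intros gs) auto
    fix s :: real assume s: "s \<in> {0..1}"
    have "exp (g (s, pi)) = 1" using g(2)[of "(s, pi)"] H(4)[OF s] s by simp
    moreover have "(exp (g (s, 0)))\<^sup>2 = 1"
      using g(2)[of "(s, 0)"] det_fixed[OF HU, of "(s, 0)"] H(4)[OF s] s by simp
    ultimately show "exp (2 * (g (s, 0) - g (s, pi))) = 1"
      unfolding exp_double by (simp add: exp_diff power_divide)
  qed simp
  moreover have "has_half_degree f n'" if "g (0, 0) - g (0, pi) = \<i> * of_real pi * of_int n'" for n'
    unfolding has_half_degree_def
  proof (intro exI[of _ "\<lambda>t. g (0, t)"] conjI ballI gt that)
    show "det (f t) = exp (g (0, t))" if "t \<in> {0..pi}" for t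
      using g(2)[of "(0, t)"] H(2)[OF that] that by simp
  qed simp
  moreover have "has_half_degree h n'" if "g (1, 0) - g (1, pi) = \<i> * of_real pi * of_int n'" for n'
    unfolding has_half_degree_def
  proof (intro exI[of _ "\<lambda>t. g (1, t)"] conjI ballI gt that)
    show "det (h t) = exp (g (1, t))" if "t \<in> {0..pi}" for t
      using g(2)[of "(1, t)"] H(3)[OF that] that by simp
  qed simp
  \<comment> \<open>The integer read off from this logarithm is a degree of both \<open>f\<close>
    and \<open>h\<close>; by uniqueness it is the given \<open>n\<close>.\<close>
  moreover have "\<exists>j::int. g (0, 0) - g (0, pi) = \<i> * of_real pi * of_int j"
  proof -
    have "exp (g (0, pi)) = 1" using g(2)[of "(0, pi)"] H(4)[of 0] by simp
    moreover have "(exp (g (0, 0)))\<^sup>2 = 1"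
      using g(2)[of "(0, 0)"] det_fixed[OF HU, of "(0, 0)"] H(4)[of 0] by simp
    ultimately have "exp (2 * (g (0, 0) - g (0, pi))) = 1"
      unfolding exp_double by (simp add: exp_diff power_divide)
    then obtain j :: int where "Re (2 * (g (0, 0) - g (0, pi))) = 0"
      "Im (2 * (g (0, 0) - g (0, pi))) = of_int (2 * j) * pi"
      unfolding exp_eq_1 by blast
    then show ?thesis by (intro exI[of _ j] complex_eqI) (auto simp: mult.commute)
  qed
  ultimately show ?thesis using has_half_degree_unique n by metis
qed

lemma half_homotopic_to_component:
  assumes f: "continuous_map (top_of_set {0..pi}) (unitary_topology m) f" and fpi: "f pi = 1\<^sub>m m"
    and p: "path_component_of (subtopology (unitary_topology m) K) (f 0) B"
  obtains h where "half_homotopic m K f h" "h 0 = B"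
proof -
  obtain c where c: "pathin (subtopology (unitary_topology m) K) c" "c 0 = f 0" "c 1 = B"
    using p unfolding path_component_of_def by blast
  have cc: "continuous_map (top_of_set {0..1}) (unitary_topology m) c" and cK: "\<And>s. s \<in> {0..1} \<Longrightarrow> c s \<in> K"
    using c(1) unfolding pathin_def continuous_map_in_subtopology by auto
  have U: "f 0 \<in> unitary_group m" "\<And>t. t \<in> {0..pi} \<Longrightarrow> f t \<in> unitary_group m"
     "\<And>s. s \<in> {0..1} \<Longrightarrow> c s \<in> unitary_group m"
    using f cc unfolding continuous_map_unitary_topology by auto
  let ?X = "top_of_set ({0..1::real} \<times> {0..pi})"
  \<comment> \<open>The argument of \<open>c\<close> is \<open>s\<close> at time 0 and 0 at time
    \<open>pi\<close>. So the start runs along \<open>c\<close> inside the fixed group, the end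
    stays \<open>f 0 * adj (f 0) = 1\<close>, and \<open>s = 0\<close> gives back
    \<open>f\<close>.\<close>
  define H where "H = (\<lambda>z. c (fst z * (1 - snd z / pi)) * (adj (f 0) * f (snd z)))"
  have "continuous_map ?X (top_of_set {0..1}) (\<lambda>z. fst z * (1 - snd z / pi))"
    by (auto simp: continuous_map_in_subtopology mult_le_one intro!: continuous_intros)
  then have "continuous_map ?X (unitary_topology m) (c \<circ> (\<lambda>z. fst z * (1 - snd z / pi)))"
    using cc continuous_map_compose by blast
  moreover have "continuous_map ?X (unitary_topology m) (\<lambda>_. adj (f 0))"
    using unitary_group_adj[OF U(1)] by simp
  ultimately have Hc: "continuous_map ?X (unitary_topology m) H"
    unfolding H_def o_def
    by (intro continuous_map_unitary_mult continuous_map_unitary_snd[OF f])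
  note f0 = unitary_groupD[OF U(1)]
  have cs: "c s * (adj (f 0) * f 0) = c s" if "s \<in> {0..1}" for s
    using f0 unitary_groupD(1)[OF U(3)[OF that]] by simp
  have "half_homotopic m K f (\<lambda>t. H (1, t))"
  proof (rule half_homotopicI[OF Hc])
    fix t assume t: "t \<in> {0..pi}"
    have "f 0 * (adj (f 0) * f t) = f t"
      using f0 unitary_groupD(1)[OF U(2)[OF t]] by (simp flip: mat_mult_assoc)
    then show "H (0, t) = f t" by (simp add: H_def c)
  next
    fix s :: real assume s: "s \<in> {0..1}"
    show "H (s, 0) \<in> K" using cs[OF s] cK[OF s] by (simp add: H_def)
    show "H (s, pi) = 1\<^sub>m m" using f0 by (simp add: H_def fpi c)
  qed simp
  moreover have "H (1, 0) = B" using cs[of 1] c by (simp add: H_def)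
  ultimately show thesis using that by blast
qed

lemma half_homotopic_last_diag:
  assumes f: "continuous_map (top_of_set {0..pi}) (unitary_topology m) f" and fpi: "f pi = 1\<^sub>m m"
    and f0: "f 0 \<in> K"
  obtains \<delta> where "continuous_on {0..pi} \<delta>" "\<And>t. t\<in>{0..pi} \<Longrightarrow> cmod (\<delta> t) = 1" "\<delta> pi = 1"
    "\<delta> 0 = 1 \<or> \<delta> 0 = - 1" "half_homotopic m K f (\<lambda>t. last_diag m (\<delta> t))"
proof -
  have "f 0 \<in> unitary_group m" using f unfolding continuous_map_unitary_topology by auto
  then obtain B where B: "B \<in> {1\<^sub>m m, last_diag m (- 1)}"
    "path_component_of (subtopology (unitary_topology m) K) (f 0) B"
    using fixed_component f0 by blast
  obtain h where h: "half_homotopic m K f h" "h 0 = B"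
    using half_homotopic_to_component[OF f fpi B(2)] by blast
  have hc: "continuous_map (top_of_set {0..pi}) (unitary_topology m) h"
    and BK: "B \<in> K" and hpi: "h pi = 1\<^sub>m m"
    using homotopic_with_imp_continuous_maps[OF h(1)] homotopic_with_imp_property[OF h(1)] h(2) by auto
  \<comment> \<open>The number of half turns, 0 or 1, that has to be removed for the path to start
    at the identity and become a loop.\<close>
  define e where "e = (if B = 1\<^sub>m m then 0 else 1 :: int)"
  have Be: "B = model m e 0" using B(1) by (auto simp: e_def model_0)
  define h' where "h' t = h t * model m (- e) t" for t
  have inv: "model m (- e) t * model m e t = 1\<^sub>m m" "model m e t * model m (- e) t = 1\<^sub>m m" for t
    unfolding model_def last_diag_mult by (simp_all add: cis_mult)
  have "continuous_map (top_of_set {0..pi}) (unitary_topology m) h'" "h' 0 = 1\<^sub>m m" "h' pi = 1\<^sub>m m"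
    unfolding h'_def
    by (intro continuous_map_unitary_mult hc continuous_map_model)
      (simp_all add: h(2) hpi model_pi Be inv)
  then obtain \<delta> where \<delta>: "continuous_on {0..pi} \<delta>" "\<forall>t\<in>{0..pi}. cmod (\<delta> t) = 1" "\<delta> 0 = 1" "\<delta> pi = 1"
    and hom: "half_homotopic m {1\<^sub>m m} h' (\<lambda>t. last_diag m (\<delta> t))"
    using half_homotopic_loop_last_diag[OF m_pos] by blast
  have "half_homotopic m K (\<lambda>t. h' t * model m e t) (\<lambda>t. last_diag m (\<delta> t) * model m e t)"
  proof (rule half_homotopic_mult_right[OF hom continuous_map_model])
    \<comment> \<open>The homotopy of loops keeps its start at the identity, so after multiplying
      back the start stays at \<open>B\<close>, which is fixed.\<close>
    show "A * model m e 0 \<in> K" if "A \<in> {1\<^sub>m m}" for A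
      using that BK unfolding Be by (simp add: model_def)
  qed (rule model_pi)
  moreover have "h' t * model m e t = h t" if "t \<in> {0..pi}" for t
  proof -
    have "h t \<in> carrier_mat m m" using hc that unfolding continuous_map_unitary_topology mat_continuous_def by auto
    then show ?thesis by (simp add: h'_def mat_mult_assoc inv)
  qed
  then have "half_homotopic m K h (\<lambda>t. h' t * model m e t)"
    using hc h(2) BK hpi by (intro homotopic_with_equal) (auto simp: h'_def Be inv model_pi)
  ultimately have "half_homotopic m K f (\<lambda>t. last_diag m (\<delta> t) * model m e t)"
    using homotopic_with_trans[OF h(1)] homotopic_with_trans by blast
  then have "half_homotopic m K f (\<lambda>t. last_diag m (\<delta> t * cis (of_int e * (pi - t))))"
    by (simp add: model_def last_diag_mult)
  moreover have "continuous_on {0..pi} (\<lambda>t. \<delta> t * cis (of_int e * (pi - t)))"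
    using \<delta> by (intro continuous_intros)
  ultimately show thesis
    using that[of "\<lambda>t. \<delta> t * cis (of_int e * (pi - t))"] \<delta>
    by (auto simp: norm_mult e_def)
qed

text \<open>Once the path is diagonal only an angle is left. It is 0 at the end and a multiple of pi
  at the start, so it can be straightened linearly with both ends fixed.\<close>

lemma half_homotopic_model:
  assumes f: "continuous_map (top_of_set {0..pi}) (unitary_topology m) f" and fpi: "f pi = 1\<^sub>m m"
    and f0: "f 0 \<in> K"
  obtains n where "half_homotopic m K f (model m n)"
proof -
  obtain \<delta> where \<delta>: "continuous_on {0..pi} \<delta>" "\<And>t. t\<in>{0..pi} \<Longrightarrow> cmod (\<delta> t) = 1" "\<delta> pi = 1"
    "\<delta> 0 = 1 \<or> \<delta> 0 = - 1" and hom: "half_homotopic m K f (\<lambda>t. last_diag m (\<delta> t))"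
    using half_homotopic_last_diag[OF assms] by blast
  obtain \<theta> where \<theta>: "continuous_on {0..pi} \<theta>" "\<And>t. t \<in> {0..pi} \<Longrightarrow> \<delta> t = cis (\<theta> t)" "\<theta> pi = 0"
    using continuous_cis_lift[OF \<delta>(1-3)] by blast
  have "sin (\<theta> 0) = 0" using \<delta>(4) \<theta>(2)[of 0] by (auto simp: complex_eq_iff)
  then obtain n :: int where n: "\<theta> 0 = of_int n * pi" by (metis sin_zero_iff_int2)
  \<comment> \<open>At time 0 both angles are \<open>n pi\<close>, so the start does not move and
    stays in the fixed group.\<close>
  let ?H = "\<lambda>(s, t). last_diag m (cis ((1 - s) * \<theta> t + s * (of_int n * (pi - t))))"
  have "half_homotopic m K (\<lambda>t. last_diag m (\<delta> t)) (model m n)"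
  proof (rule half_homotopicI[of _ ?H])
    have "continuous_on ({0..1::real} \<times> {0..pi}) (\<lambda>z. \<theta> (snd z))"
      by (rule continuous_on_compose2[OF \<theta>(1)]) (auto intro: continuous_intros)
    then show "continuous_map (top_of_set ({0..1} \<times> {0..pi})) (unitary_topology m) ?H"
      unfolding case_prod_beta
      by (intro continuous_map_last_diag) (auto intro!: continuous_intros)
    fix s :: real assume "s \<in> {0..1}"
    have "(1 - s) * \<theta> 0 + s * (of_int n * (pi - 0)) = \<theta> 0" by (simp add: n algebra_simps)
    then have "?H (s, 0) = last_diag m (\<delta> 0)" using \<theta>(2)[of 0] by simp
    then show "?H (s, 0) \<in> K" using homotopic_with_imp_property[OF hom] by simp
    show "?H (s, pi) = 1\<^sub>m m" using \<theta>(3) by simp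
  qed (simp_all add: \<theta>(2) model_def)
  then show thesis using that homotopic_with_trans[OF hom] by blast
qed

end

lemma bij_betw_quotient:
  assumes deg: "\<And>x. x \<in> X \<Longrightarrow> deg x \<in> T" and surj: "\<And>n. n \<in> T \<Longrightarrow> \<exists>x\<in>X. deg x = n"
    and rel: "\<And>x y. x \<in> X \<Longrightarrow> (x, y) \<in> r \<longleftrightarrow> y \<in> X \<and> deg x = deg y"
  shows "bij_betw (\<lambda>n. {x \<in> X. deg x = n}) T (X // r)"
proof (rule bij_betw_imageI)
  show "inj_on (\<lambda>n. {x \<in> X. deg x = n}) T"
  proof (rule inj_onI)
    fix n n' assume "n \<in> T" "n' \<in> T" and eq: "{x \<in> X. deg x = n} = {x \<in> X. deg x = n'}"
    then obtain x where x: "x \<in> X" "deg x = n" using surj by meson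
    have "x \<in> {x \<in> X. deg x = n'}" unfolding eq[symmetric] using x by simp
    then show "n = n'" using x by simp
  qed
  have img: "r `` {x} = {y \<in> X. deg y = deg x}" if "x \<in> X" for x
  proof (rule Set.set_eqI)
    show "y \<in> r `` {x} \<longleftrightarrow> y \<in> {y \<in> X. deg y = deg x}" for y
      unfolding Image_singleton_iff mem_Collect_eq rel[OF that] by (rule conj_cong[OF refl eq_commute])
  qed
  show "(\<lambda>n. {x \<in> X. deg x = n}) ` T = X // r"
  proof (intro equalityI subsetI)
    fix C assume "C \<in> (\<lambda>n. {x \<in> X. deg x = n}) ` T"
    then obtain n where "n \<in> T" "C = {x \<in> X. deg x = n}" by blast
    moreover from this surj obtain x where "x \<in> X" "deg x = n" by meson
    ultimately have "C = r `` {x}" using img by simp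
    then show "C \<in> X // r" using \<open>x \<in> X\<close> by (auto intro: quotientI)
  next
    fix C assume "C \<in> X // r"
    then obtain x where "x \<in> X" "C = r `` {x}" by (rule quotientE)
    then show "C \<in> (\<lambda>n. {x \<in> X. deg x = n}) ` T" using img deg by auto
  qed
qed

section \<open>From paths on the half interval back to equivariant loops\<close>

context unitary_involution
begin

definition extend :: "(real \<Rightarrow> complex mat) \<Rightarrow> real \<Rightarrow> complex mat" where
  "extend f k = (if 0 \<le> k then f k else G (f (- k)))"

text \<open>The two halves agree at time 0 precisely because the values there are fixed by
  \<open>G\<close>. The parameter set \<open>S\<close> is the unit interval for homotopies and a
  single point for one path.\<close>

lemma continuous_map_extend:
  fixes H :: "'a::topological_space \<times> real \<Rightarrow> complex mat"
  assumes H: "continuous_map (top_of_set (S \<times> {0..pi})) (unitary_topology m) H"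
    and H0: "\<And>s. s \<in> S \<Longrightarrow> H (s, 0) \<in> K"
  shows "continuous_map (top_of_set (S \<times> {-pi..pi})) (unitary_topology m) (\<lambda>z. extend (\<lambda>t. H (fst z, t)) (snd z))"
proof -
  let ?X = "top_of_set (S \<times> {-pi..pi})"
  have "continuous_map ?X (unitary_topology m)
     (\<lambda>z. if 0 \<le> snd z then H z else (G \<circ> (H \<circ> (\<lambda>z. (fst z, - snd z)))) z)"
  proof (rule continuous_map_cases_le)
    show "continuous_map (subtopology ?X {x \<in> topspace ?X. 0 \<le> snd x}) (unitary_topology m) H"
      unfolding subtopology_subtopology
      by (rule continuous_map_from_subtopology_mono[OF H]) auto
    have "continuous_map (subtopology ?X {x \<in> topspace ?X. snd x \<le> 0}) (top_of_set (S \<times> {0..pi}))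
       (\<lambda>z. (fst z, - snd z))"
      unfolding subtopology_subtopology
      by (auto simp: continuous_map_in_subtopology intro!: continuous_intros)
    then show "continuous_map (subtopology ?X {x \<in> topspace ?X. snd x \<le> 0}) (unitary_topology m)
       (G \<circ> (H \<circ> (\<lambda>z. (fst z, - snd z))))"
      by (intro continuous_map_compose[OF _ G_cont] continuous_map_compose[OF _ H])
    show "H x = (G \<circ> (H \<circ> (\<lambda>z. (fst z, - snd z)))) x" if "x \<in> topspace ?X" "0 = snd x" for x
      using H0[of "fst x"] that by (cases x) auto
  qed (auto intro!: continuous_intros)
  then show ?thesis by (simp add: extend_def o_def cong: if_cong)
qed

lemma equivariant_loop_extend:
  assumes "f 0 \<in> K" "f pi = 1\<^sub>m m" "\<And>t. t \<in> {0..pi} \<Longrightarrow> f t \<in> unitary_group m"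
  shows "equivariant_loop G (1\<^sub>m m) (extend f)"
  unfolding equivariant_loop_def
proof (intro conjI ballI)
  fix k assume k: "k \<in> {-pi..pi}"
  show "extend f (- k) = G (extend f k)"
    using assms(1) assms(3)[of "- k"] k by (cases k "0::real" rule: linorder_cases) (auto simp: extend_def G_invol)
next
  have "\<not> pi \<le> 0" using pi_gt_zero by linarith
  then show "extend f (- pi) = 1\<^sub>m m" "extend f pi = 1\<^sub>m m"
    using assms by (simp_all add: extend_def G_one)
qed

abbreviation loops :: "(real \<Rightarrow> complex mat) set" where
  "loops \<equiv> equivariant_loops (unitary_topology m) G (1\<^sub>m m)"

lemma loopsD:
  assumes "f \<in> loops"
  shows "continuous_map (top_of_set {0..pi}) (unitary_topology m) f" "f 0 \<in> K" "f pi = 1\<^sub>m m"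
    "\<And>k. k \<in> {-pi..pi} \<Longrightarrow> extend f k = f k"
proof -
  have c: "continuous_map (top_of_set {-pi..pi}) (unitary_topology m) f"
    and e: "\<And>k. k \<in> {-pi..pi} \<Longrightarrow> f (- k) = G (f k)" "f pi = 1\<^sub>m m"
    using assms unfolding equivariant_loops_def equivariant_loop_def by auto
  show "continuous_map (top_of_set {0..pi}) (unitary_topology m) f"
    by (rule continuous_map_from_subtopology_mono[OF c]) auto
  show "f 0 \<in> K" using e(1)[of 0] by simp
  show "f pi = 1\<^sub>m m" by (rule e)
  show "extend f k = f k" if "k \<in> {-pi..pi}" for k
    using e(1)[of "- k"] that by (simp add: extend_def)
qed

text \<open>Restriction to the half interval gives one direction. For the other, each stage of a
  homotopy on the half starts in the fixed group, so the stages extend together to equivariant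
  loops.\<close>

lemma homotopic_loops_iff:
  assumes f: "f \<in> loops" and h: "h \<in> loops"
  shows "homotopic_with (equivariant_loop G (1\<^sub>m m)) (top_of_set {-pi..pi}) (unitary_topology m) f h
    \<longleftrightarrow> half_homotopic m K f h"
proof
  assume L: "homotopic_with (equivariant_loop G (1\<^sub>m m)) (top_of_set {-pi..pi}) (unitary_topology m) f h"
  have "half_homotopic m K (f \<circ> id) (h \<circ> id)"
  proof (rule homotopic_with_compose_continuous_map_right[OF L])
    show "continuous_map (top_of_set {0..pi}) (top_of_set {-pi..pi}) id"
      by (auto simp: continuous_map_in_subtopology)
    show "(j \<circ> id) 0 \<in> K \<and> (j \<circ> id) pi = 1\<^sub>m m" if "equivariant_loop G (1\<^sub>m m) j" for j
      using that unfolding equivariant_loop_def by (auto dest: bspec[of _ _ 0])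
  qed
  then show "half_homotopic m K f h" by simp
next
  assume "half_homotopic m K f h"
  then obtain H where H: "continuous_map (top_of_set ({0..1::real} \<times> {0..pi})) (unitary_topology m) H"
    "\<And>t. t\<in>{0..pi} \<Longrightarrow> H (0, t) = f t" "\<And>t. t\<in>{0..pi} \<Longrightarrow> H (1, t) = h t"
    "\<And>s. s\<in>{0..1} \<Longrightarrow> H (s, 0) \<in> K \<and> H (s, pi) = 1\<^sub>m m"
    unfolding half_homotopic_iff by blast
  have HU: "H x \<in> unitary_group m" if "x \<in> {0..1} \<times> {0..pi}" for x
    using H(1) that unfolding continuous_map_unitary_topology by auto
  let ?P = "equivariant_loop G (1\<^sub>m m)"
  have cong: "extend u k = extend v k" if "\<And>t. t \<in> {0..pi} \<Longrightarrow> u t = v t" "k \<in> {-pi..pi}" for u v k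
    using that by (auto simp: extend_def)
  \<comment> \<open>The description of \<open>homotopic_with\<close> by a single map on the product
    requires a property that depends only on the values on the interval.\<close>
  have *: "?P u \<longleftrightarrow> ?P v" if "\<And>x. x \<in> topspace (top_of_set {-pi..pi}) \<Longrightarrow> u x = v x" for u v
    using that unfolding equivariant_loop_def by auto
  show "homotopic_with ?P (top_of_set {-pi..pi}) (unitary_topology m) f h"
  proof (rule iffD2[OF homotopic_with[OF *]], assumption, intro exI[of _ "\<lambda>z. extend (\<lambda>t. H (fst z, t)) (snd z)"] conjI ballI)
    show "continuous_map (prod_topology (top_of_set {0..1}) (top_of_set {-pi..pi})) (unitary_topology m)
       (\<lambda>z. extend (\<lambda>t. H (fst z, t)) (snd z))"
      unfolding prod_topology_subtopology_eu by (rule continuous_map_extend) (use H in auto)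
    fix k assume "k \<in> topspace (top_of_set {-pi..pi})"
    then have k: "k \<in> {-pi..pi}" by simp
    show "extend (\<lambda>t. H (fst (0::real, k), t)) (snd (0::real, k)) = f k"
      using cong[of "\<lambda>t. H (0, t)" f k] H(2) k loopsD(4)[OF f k] by simp
    show "extend (\<lambda>t. H (fst (1::real, k), t)) (snd (1::real, k)) = h k"
      using cong[of "\<lambda>t. H (1, t)" h k] H(3) k loopsD(4)[OF h k] by simp
  next
    fix s :: real assume s: "s \<in> {0..1}"
    have "?P (extend (\<lambda>t. H (s, t)))"
      using H(4)[OF s] HU s by (intro equivariant_loop_extend) auto
    then show "?P (\<lambda>x. extend (\<lambda>t. H (fst (s, x), t)) (snd (s, x)))" by simp
  qed
qed

text \<open>The degree is read off from a model rather than from a lift of \<open>f\<close>. This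
  shows at the same time that the start of the model is fixed by \<open>G\<close>, which restricts
  the possible \<open>n\<close>.\<close>

lemma half_degree_exists:
  assumes "f \<in> loops"
  shows "\<exists>n. has_half_degree f n \<and> model m n 0 \<in> K \<and> half_homotopic m K f (model m n)"
proof -
  obtain n where n: "half_homotopic m K f (model m n)"
    using half_homotopic_model[OF loopsD(1,3,2)[OF assms]] by blast
  have "has_half_degree f n"
    using half_homotopic_degree[OF _ has_half_degree_model[OF m_pos]] homotopic_with_symD[OF n] by blast
  moreover have "model m n 0 \<in> K" using homotopic_with_imp_property[OF n] by blast
  ultimately show ?thesis using n by blast
qed

definition half_degree :: "(real \<Rightarrow> complex mat) \<Rightarrow> int" where
  "half_degree f = (THE n. has_half_degree f n)"

lemma half_degree_eqI: "has_half_degree f n \<Longrightarrow> half_degree f = n"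
  unfolding half_degree_def using has_half_degree_unique by blast

lemma homotopic_loops_iff_half_degree:
  assumes f: "f \<in> loops" and h: "h \<in> loops"
  shows "homotopic_with (equivariant_loop G (1\<^sub>m m)) (top_of_set {-pi..pi}) (unitary_topology m) f h
    \<longleftrightarrow> half_degree f = half_degree h"
proof -
  obtain n where n: "has_half_degree f n" "half_homotopic m K f (model m n)"
    using half_degree_exists[OF f] by blast
  obtain n' where n': "has_half_degree h n'" "half_homotopic m K h (model m n')"
    using half_degree_exists[OF h] by blast
  have "half_homotopic m K f h \<longleftrightarrow> n = n'"
  proof
    assume "half_homotopic m K f h"
    then show "n = n'" using half_homotopic_degree n(1) n'(1) has_half_degree_unique by blast
  next
    assume "n = n'"
    then show "half_homotopic m K f h"
      using homotopic_with_trans[OF n(2)] homotopic_with_symD[OF n'(2)] by blast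
  qed
  then show ?thesis
    unfolding homotopic_loops_iff[OF assms] half_degree_eqI[OF n(1)] half_degree_eqI[OF n'(1)] .
qed

lemma extend_model_loop:
  assumes "model m n 0 \<in> K"
  shows "extend (model m n) \<in> loops" "half_degree (extend (model m n)) = n"
proof -
  have U: "model m n t \<in> unitary_group m" for t
    using continuous_map_model[of UNIV m n] unfolding continuous_map_unitary_topology by auto
  \<comment> \<open>A single path is treated as a family over one point in order to use
    \<open>continuous_map_extend\<close>.\<close>
  have "continuous_map (top_of_set ({0::real} \<times> {-pi..pi})) (unitary_topology m)
     (\<lambda>z. extend (\<lambda>t. (\<lambda>z. model m n (snd z)) (fst z, t)) (snd z))"
    by (intro continuous_map_extend continuous_map_unitary_snd continuous_map_model) (use assms in auto)
  moreover have "continuous_map (top_of_set {-pi..pi}) (top_of_set ({0::real} \<times> {-pi..pi})) (Pair 0)"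
    by (auto simp: continuous_map_in_subtopology intro!: continuous_intros)
  ultimately have "continuous_map (top_of_set {-pi..pi}) (unitary_topology m)
     ((\<lambda>z. extend (\<lambda>t. (\<lambda>z. model m n (snd z)) (fst z, t)) (snd z)) \<circ> Pair (0::real))"
    by (rule continuous_map_compose[rotated])
  then have "continuous_map (top_of_set {-pi..pi}) (unitary_topology m) (extend (model m n))"
    by (simp add: o_def)
  then show "extend (model m n) \<in> loops"
    unfolding equivariant_loops_def
    using equivariant_loop_extend[of "model m n"] assms model_pi U by auto
  have "has_half_degree (extend (model m n)) n \<longleftrightarrow> has_half_degree (model m n) n"
    unfolding has_half_degree_def by (simp add: extend_def)
  then show "half_degree (extend (model m n)) = n"
    using has_half_degree_model[OF m_pos] half_degree_eqI by blast
qed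

theorem loop_classes_bij_int:
  "\<exists>\<phi>. bij_betw \<phi> (equivariant_loop_classes (unitary_topology m) G (1\<^sub>m m)) (UNIV :: int set)"
proof -
  let ?T = "{n. model m n 0 \<in> K}"
  have bij: "bij_betw (\<lambda>n. {f \<in> loops. half_degree f = n}) ?T
      (equivariant_loop_classes (unitary_topology m) G (1\<^sub>m m))"
    unfolding equivariant_loop_classes_def
  proof (rule bij_betw_quotient)
    show "half_degree f \<in> ?T" if "f \<in> loops" for f
      using half_degree_exists[OF that] half_degree_eqI by auto
    show "\<exists>f\<in>loops. half_degree f = n" if "n \<in> ?T" for n
      using extend_model_loop[of n] that by blast
    fix f h assume f: "f \<in> loops"
    have "h \<in> loops"
      if "homotopic_with (equivariant_loop G (1\<^sub>m m)) (top_of_set {-pi..pi}) (unitary_topology m) f h"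
      using homotopic_with_imp_continuous_maps[OF that] homotopic_with_imp_property[OF that]
      by (simp add: equivariant_loops_def)
    then show "(f, h) \<in> {(f, h). homotopic_with (equivariant_loop G (1\<^sub>m m)) (top_of_set {-pi..pi}) (unitary_topology m) f h}
      \<longleftrightarrow> h \<in> loops \<and> half_degree f = half_degree h"
      using homotopic_loops_iff_half_degree[OF f] by blast
  qed
  \<comment> \<open>The identity is fixed, so every even degree occurs; the odd ones occur exactly
    if \<open>last_diag m (- 1)\<close> is fixed. Either set of degrees is in bijection with the
    integers.\<close>
  have "\<exists>e. bij_betw e ?T (UNIV :: int set)"
  proof (cases "last_diag m (- 1) \<in> K")
    case True
    then have "?T = UNIV" using G_one by (auto simp: model_0)
    then show ?thesis using bij_betw_id by auto
  next
    case False
    then have "?T = {n. even n}" using G_one by (auto simp: model_0 split: if_splits)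
    moreover have "bij_betw (\<lambda>n::int. n div 2) {n. even n} UNIV"
      by (rule bij_betw_byWitness[where f' = "\<lambda>n. 2 * n"]) auto
    ultimately show ?thesis by auto
  qed
  then obtain e :: "int \<Rightarrow> int" where "bij_betw e ?T UNIV" by blast
  then show ?thesis
    using bij_betw_trans[OF bij_betw_inv_into[OF bij]] by blast
qed

end

section \<open>Path components of the fixed groups\<close>

text \<open>A rotation in the plane of the first two coordinates. Its \<open>2 \<times> 2\<close>
  block is real and is also a unit quaternion, so it belongs to both fixed groups; at angle pi it
  changes the sign of the corner entry.\<close>

definition givens :: "nat \<Rightarrow> real \<Rightarrow> complex mat" where
  "givens m \<theta> = four_block_mat
     (Matrix.mat 2 2 (\<lambda>(i, j). complex_of_real
        (if i = j then cos \<theta> else if i = 0 then - sin \<theta> else sin \<theta>)))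
     (0\<^sub>m 2 (m - 2)) (0\<^sub>m (m - 2) 2) (1\<^sub>m (m - 2))"

lemma givens_carrier: "2 \<le> m \<Longrightarrow> givens m \<theta> \<in> carrier_mat m m"
  by (rule carrier_matI) (auto simp: givens_def)

lemma givens_dim [simp]: "2 \<le> m \<Longrightarrow> dim_row (givens m \<theta>) = m" "2 \<le> m \<Longrightarrow> dim_col (givens m \<theta>) = m"
  by (auto simp: givens_def)

lemma givens_index:
  assumes "i < m" "j < m" "2 \<le> m"
  shows "givens m \<theta> $$ (i, j) =
    (if i < 2 \<and> j < 2 then complex_of_real (if i = j then cos \<theta> else if i = 0 then - sin \<theta> else sin \<theta>)
     else if i = j then 1 else 0)"
  using assms by (auto simp: givens_def)

lemma adj_givens: "2 \<le> m \<Longrightarrow> adj (givens m \<theta>) = givens m (- \<theta>)"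
  using givens_carrier[of m] by (intro eq_matI) (auto simp: givens_index)

lemma givens_unitary:
  assumes m: "2 \<le> m"
  shows "givens m \<theta> \<in> unitary_group m"
proof (rule unitary_groupI)
  show car: "givens m \<theta> \<in> carrier_mat m m" by (rule givens_carrier[OF m])
  let ?Q = "\<lambda>\<theta>. Matrix.mat 2 2 (\<lambda>(i, j). complex_of_real
        (if i = j then cos \<theta> else if i = 0 then - sin \<theta> else sin \<theta>))"
  have cs: "complex_of_real (cos \<theta>) * complex_of_real (cos \<theta>) + complex_of_real (sin \<theta>) * complex_of_real (sin \<theta>) = 1"
    using sin_cos_squared_add3[of \<theta>] by (metis of_real_1 of_real_add of_real_mult)
  have QQ: "?Q (- \<theta>) * ?Q \<theta> = 1\<^sub>m 2"
  proof (rule eq_matI)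
    fix i j assume "i < dim_row (1\<^sub>m 2 :: complex mat)" "j < dim_col (1\<^sub>m 2 :: complex mat)"
    then have "i = 0 \<or> i = 1" "j = 0 \<or> j = 1" by auto
    then show "(?Q (- \<theta>) * ?Q \<theta>) $$ (i, j) = 1\<^sub>m 2 $$ (i, j)"
      using cs by (elim disjE) (simp_all add: scalar_prod_def numeral_2_eq_2 add.commute)
  qed simp_all
  have "givens m (- \<theta>) * givens m \<theta> = four_block_mat (?Q (- \<theta>) * ?Q \<theta>) (0\<^sub>m 2 (m - 2)) (0\<^sub>m (m - 2) 2) (1\<^sub>m (m - 2))"
    unfolding givens_def by (subst mult_four_block_mat[of _ 2 2 _ "m - 2" _ "m - 2" _ _ 2 _ "m - 2"]) auto
  also have "\<dots> = 1\<^sub>m m" unfolding QQ four_block_one_mat using m by (intro arg_cong[of _ _ "one_mat"]) simp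
  finally show "adj (givens m \<theta>) * givens m \<theta> = 1\<^sub>m m" by (simp add: adj_givens[OF m])
qed

lemma givens_0: "2 \<le> m \<Longrightarrow> givens m 0 = 1\<^sub>m m"
  using givens_carrier[of m] by (intro eq_matI) (auto simp: givens_index)

lemma givens_pi_mult_00:
  assumes "2 \<le> m" "A \<in> carrier_mat m m"
  shows "(givens m pi * A) $$ (0, 0) = - A $$ (0, 0)"
proof -
  have "(givens m pi * A) $$ (0, 0) = (\<Sum>l\<in>{0..<m}. givens m pi $$ (0, l) * A $$ (l, 0))"
    using assms givens_carrier[OF assms(1), of pi] by (simp add: scalar_prod_def)
  also have "\<dots> = (\<Sum>l\<in>{0..<m}. if l = 0 then - A $$ (0, 0) else 0)"
    using assms by (intro sum.cong) (auto simp: givens_index)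
  finally show ?thesis using assms by simp
qed

lemma continuous_map_givens:
  assumes "continuous_map X euclideanreal \<theta>" "2 \<le> m"
  shows "continuous_map X (unitary_topology m) (\<lambda>x. givens m (\<theta> x))"
  unfolding continuous_map_unitary_topology
proof (intro conjI ballI mat_continuousI)
  fix i j assume ij: "i < m" "j < m"
  have "continuous_map X euclidean (\<lambda>x. complex_of_real (cos (\<theta> x)))"
    "continuous_map X euclidean (\<lambda>x. complex_of_real (sin (\<theta> x)))"
    "continuous_map X euclidean (\<lambda>x. - complex_of_real (sin (\<theta> x)))"
    using assms(1)
    by (rule continuous_map_compose1[where h = "\<lambda>t. complex_of_real (cos t)"]
          continuous_map_compose1[where h = "\<lambda>t. complex_of_real (sin t)"]
          continuous_map_compose1[where h = "\<lambda>t. - complex_of_real (sin t)"], intro continuous_intros)+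
  then show "continuous_map X euclidean (\<lambda>x. givens m (\<theta> x) $$ (i, j))"
    using ij assms(2) by (cases "i < 2 \<and> j < 2"; cases "i = j"; cases "i = 0") (simp_all add: givens_index)
qed (use assms in \<open>auto intro: givens_unitary givens_carrier\<close>)

text \<open>\<open>R\<close> stands for the real matrices (\<open>k = 1\<close>) or the quaternionic matrices in their
  complex \<open>2 \<times> 2\<close> block form (\<open>k = 2\<close>), of all shapes.\<close>

locale block_star_algebra =
  fixes k :: nat and R :: "complex mat set"
  assumes k_pos: "0 < k"
    and R_mult: "\<And>A B. \<lbrakk>A \<in> R; B \<in> R; dim_col A = dim_row B\<rbrakk> \<Longrightarrow> A * B \<in> R"
    and R_adj: "\<And>A. A \<in> R \<Longrightarrow> adj A \<in> R"
    and R_add: "\<And>A B. \<lbrakk>A \<in> R; B \<in> R; dim_row A = dim_row B; dim_col A = dim_col B\<rbrakk> \<Longrightarrow> A + B \<in> R"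
    and R_smult: "\<And>A a. A \<in> R \<Longrightarrow> complex_of_real a \<cdot>\<^sub>m A \<in> R"
    and R_one: "\<And>n. 1\<^sub>m (k * n) \<in> R"
    and R_frame: "\<And>n. frame (k + k * n) k \<in> R"
    and R_givens: "\<And>n \<theta>. 2 \<le> k * n \<Longrightarrow> givens (k * n) \<theta> \<in> R"
    and R_block: "\<And>A n. A \<in> carrier_mat (k * n) (k * n) \<Longrightarrow> block k A \<in> R \<longleftrightarrow> A \<in> R"
    and R_norm: "\<And>c. \<lbrakk>c \<in> R; c \<in> carrier_mat k k\<rbrakk>
      \<Longrightarrow> adj c * c = complex_of_real (first_col_norm2 c) \<cdot>\<^sub>m 1\<^sub>m k"
begin

abbreviation R_topology :: "nat \<Rightarrow> complex mat topology" where
  "R_topology m \<equiv> subtopology (unitary_topology m) R"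

lemma R_minus: "\<lbrakk>A \<in> R; B \<in> R; dim_row A = dim_row B; dim_col A = dim_col B\<rbrakk> \<Longrightarrow> A - B \<in> R"
proof -
  assume *: "A \<in> R" "B \<in> R" "dim_row A = dim_row B" "dim_col A = dim_col B"
  have "A + complex_of_real (- 1) \<cdot>\<^sub>m B \<in> R" using * by (intro R_add R_smult) auto
  moreover have "A + complex_of_real (- 1) \<cdot>\<^sub>m B = A - B" using * by (intro eq_matI) auto
  ultimately show ?thesis by simp
qed

lemma R_pivot:
  assumes "V \<in> R" "V \<in> carrier_mat (k + k * n) k"
  shows "pivot (k + k * n) k s V \<in> R"
  unfolding pivot_def using assms R_one[of 1]
  by (intro R_add R_smult R_mult R_adj R_frame) auto

lemma R_flip: "flip (k + k * n) k \<in> R"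
proof -
  have "1\<^sub>m (k + k * n) - complex_of_real 2 \<cdot>\<^sub>m (frame (k + k * n) k * adj (frame (k + k * n) k)) \<in> R"
    using R_one[of "Suc n"] by (intro R_minus R_smult R_mult R_adj R_frame) auto
  then show ?thesis by (simp add: flip_def)
qed

text \<open>The rotation is built from \<open>A\<close>, the frame and identities by sums, products,
  adjoints and real scalars. Even the inverse of the pivot has this form, since it is written as the
  adjoint divided by a real number.\<close>

lemma R_rotation:
  assumes "A \<in> R" "A \<in> carrier_mat (k + k * n) (k + k * n)"
  shows "rotation (k + k * n) k s A \<in> R"
proof -
  let ?m = "k + k * n"
  have V: "A * frame ?m k \<in> R" "A * frame ?m k \<in> carrier_mat ?m k"
    using assms by (auto intro!: R_mult R_frame)
  show ?thesis
    unfolding rotation_def householder_def Let_def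
    using R_one[of "Suc n"] V R_pivot[OF V] assms(1) carrier_matD[OF assms(2)]
    by (intro R_mult R_flip R_minus R_add R_adj R_smult R_frame) auto
qed

lemma R_rotatable:
  assumes "A \<in> R" "A \<in> carrier_mat (k + k * n) (k + k * n)" "A $$ (0, 0) \<noteq> - 1"
  shows "rotatable (k + k * n) k A"
proof -
  let ?m = "k + k * n"
  have V: "A * frame ?m k \<in> R" "A * frame ?m k \<in> carrier_mat ?m k"
    using assms by (auto intro!: R_mult R_frame)
  show ?thesis
    unfolding rotatable_def Let_def using assms(3) V
    by (intro conjI allI R_norm R_pivot V carrier_matI pivot_dim)
qed

lemma path_component_block:
  assumes A: "A \<in> unitary_group (k + k * n)" "A \<in> R" and A0: "A $$ (0, 0) \<noteq> - 1"
  obtains B where "B \<in> unitary_group (k * n)" "B \<in> R"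
    "path_component_of (R_topology (k + k * n)) A (block k B)"
proof -
  let ?m = "k + k * n"
  note car = unitary_groupD(1)[OF A(1)]
  note rot = R_rotatable[OF A(2) car A0]
  let ?c = "\<lambda>s. rotation ?m k s A * A"
  let ?B = "lower_block k (?c 1)"
  have B: "?B \<in> unitary_group (k * n)" "?c 1 = block k ?B"
    using rotation_one[OF A(1) k_pos rot] by auto
  have cR: "?c s \<in> R" if "0 \<le> s" "s \<le> 1" for s
    using unitary_groupD(1)[OF rotation_unitary[OF A(1) k_pos _ rot that]] car
    by (intro R_mult R_rotation A car) auto
  have "continuous_map (top_of_set {0..1}) (unitary_topology ?m) ?c"
    using A k_pos rot by (intro continuous_map_rotation) auto
  then have "pathin (R_topology ?m) ?c"
    unfolding pathin_def continuous_map_in_subtopology using cR by auto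
  moreover have "?c 0 = A" using rotation_zero[OF A(1) k_pos] car by simp
  ultimately have "path_component_of (R_topology ?m) A (?c 1)"
    unfolding path_component_of_def by blast
  moreover have "?B \<in> R"
    using cR[of 1] B R_block[OF unitary_groupD(1)[OF B(1)]] by simp
  ultimately show thesis using that B by simp
qed

text \<open>A second coordinate leaves room for a half turn that replaces the corner entry -1 by 1.
  In size 1 there is none, and the matrix with entry -1 cannot be joined to the identity within the
  real matrices.\<close>

lemma path_component_block':
  assumes A: "A \<in> unitary_group (k + k * n)" "A \<in> R" and m: "2 \<le> k + k * n"
  obtains B where "B \<in> unitary_group (k * n)" "B \<in> R"
    "path_component_of (R_topology (k + k * n)) A (block k B)"
proof (cases "A $$ (0, 0) = - 1")
  case False
  then show thesis using path_component_block[OF A] that by blast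
next
  case True
  let ?m = "k + k * n"
  note car = unitary_groupD(1)[OF A(1)]
  let ?c = "\<lambda>s. givens ?m (pi * s) * A"
  have gR: "givens ?m \<theta> \<in> R" for \<theta> using R_givens[of "Suc n"] m by simp
  have cR: "?c s \<in> R" for s
    using gR A car givens_carrier[OF m] by (intro R_mult) auto
  have "continuous_map (top_of_set {0..1}) (unitary_topology ?m) ?c"
    using A m by (intro continuous_map_unitary_mult continuous_map_givens) (auto intro!: continuous_intros)
  then have "pathin (R_topology ?m) ?c"
    unfolding pathin_def continuous_map_in_subtopology using cR by auto
  moreover have "?c 0 = A" using givens_0[OF m] car by simp
  ultimately have p: "path_component_of (R_topology ?m) A (?c 1)"
    unfolding path_component_of_def by blast
  have "?c 1 $$ (0, 0) \<noteq> - 1" using givens_pi_mult_00[OF m car] True by simp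
  moreover have "?c 1 \<in> unitary_group ?m"
    by (intro unitary_group_mult A givens_unitary m)
  ultimately obtain B where "B \<in> unitary_group (k * n)" "B \<in> R"
    "path_component_of (R_topology ?m) (?c 1) (block k B)"
    using path_component_block[OF _ cR] by blast
  then show thesis using that path_component_of_trans[OF p] by blast
qed

lemma path_component_block_mono:
  assumes "path_component_of (R_topology (k * n)) A B"
  shows "path_component_of (R_topology (k + k * n)) (block k A) (block k B)"
proof (rule path_component_of_continuous_image[OF _ assms])
  have "block k A \<in> R" if "A \<in> unitary_group (k * n)" "A \<in> R" for A
    using R_block[OF unitary_groupD(1)[OF that(1)]] that by simp
  then show "continuous_map (R_topology (k * n)) (R_topology (k + k * n)) (block k)"
    using continuous_map_from_subtopology[OF continuous_map_block]
    by (auto simp: continuous_map_in_subtopology)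
qed

end

section \<open>Class BDI: real matrices and the orthogonal group\<close>

definition real_matrices :: "complex mat set" where
  "real_matrices = {A. \<forall>i<dim_row A. \<forall>j<dim_col A. A $$ (i, j) \<in> \<real>}"

lemma real_matrices_iff: "A \<in> real_matrices \<longleftrightarrow> map_mat cnj A = A"
proof -
  have "A \<in> real_matrices \<longleftrightarrow> (\<forall>i<dim_row A. \<forall>j<dim_col A. cnj (A $$ (i, j)) = A $$ (i, j))"
    by (simp add: real_matrices_def Reals_cnj_iff)
  also have "\<dots> \<longleftrightarrow> map_mat cnj A = A"
    by (auto simp: mat_eq_iff)
  finally show ?thesis .
qed

interpretation real_structure: block_star_algebra 1 real_matrices
proof
  fix A B :: "complex mat" assume "A \<in> real_matrices" "B \<in> real_matrices" "dim_col A = dim_row B"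
  then show "A * B \<in> real_matrices"
    by (auto simp: real_matrices_def scalar_prod_def intro!: sum_in_Reals Reals_mult)
next
  fix A :: "complex mat" assume "A \<in> real_matrices"
  then show "adj A \<in> real_matrices"
    by (auto simp: real_matrices_def Reals_cnj_iff)
next
  fix A :: "complex mat" and n assume "A \<in> carrier_mat (1 * n) (1 * n)"
  then have A: "A \<in> carrier_mat n n" by simp
  show "block 1 A \<in> real_matrices \<longleftrightarrow> A \<in> real_matrices"
  proof
    assume L: "block 1 A \<in> real_matrices"
    have "A $$ (i, j) \<in> \<real>" if "i < n" "j < n" for i j
    proof -
      have "block 1 A $$ (i + 1, j + 1) \<in> \<real>" using L A that by (auto simp: real_matrices_def)
      then show ?thesis using A that by (simp add: block_index)
    qed
    then show "A \<in> real_matrices" using A by (auto simp: real_matrices_def)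
  next
    assume "A \<in> real_matrices"
    then show "block 1 A \<in> real_matrices" using A by (auto simp: real_matrices_def block_index)
  qed
next
  fix n \<theta> assume n: "2 \<le> 1 * (n::nat)"
  then show "givens (1 * n) \<theta> \<in> real_matrices"
    using givens_carrier[of "1 * n"] by (auto simp: real_matrices_def givens_index)
next
  fix c :: "complex mat" assume "c \<in> carrier_mat 1 1"
  then show "adj c * c = complex_of_real (first_col_norm2 c) \<cdot>\<^sub>m 1\<^sub>m 1"
    by (rule first_col_norm2_1x1)
qed (auto simp: real_matrices_def)

text \<open>Splitting off one coordinate at a time ends in \<open>O(1)\<close>, which consists of 1
  and -1; the surviving sign is the last diagonal entry.\<close>

lemma orthogonal_path_component:
  assumes "0 < m" "A \<in> unitary_group m" "A \<in> real_matrices"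
  shows "\<exists>B\<in>{1\<^sub>m m, last_diag m (- 1)}. path_component_of (subtopology (unitary_topology m) real_matrices) A B"
  using assms
proof (induction m arbitrary: A)
  case (Suc n)
  show ?case
  proof (cases "n = 0")
    case True
    note A = unitary_groupD[OF Suc.prems(2)]
    let ?a = "A $$ (0, 0)"
    have "cmod ?a \<le> 1" "(\<Sum>i<1. (cmod (A $$ (i, 0)))\<^sup>2) = 1"
      using isometry_first_col[of A 1 1] isometry_entry_le_1[of A 1 1 0] A True by auto
    then have "cmod ?a = 1" by (simp add: power2_eq_1_iff) (smt (verit) norm_ge_zero)
    moreover have "?a \<in> \<real>" using Suc.prems(3) A(1) by (auto simp: real_matrices_def)
    ultimately have "?a = 1 \<or> ?a = - 1"
      by (elim Reals_cases) (auto simp: abs_if split: if_splits)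
    moreover have "A = last_diag (Suc n) ?a"
      using A(1) True by (intro eq_matI) (auto simp: last_diag_def)
    ultimately have "A \<in> {1\<^sub>m (Suc n), last_diag (Suc n) (- 1)}" by (metis insert_iff last_diag_one)
    moreover have "path_component_of (subtopology (unitary_topology (Suc n)) real_matrices) A A"
      using Suc.prems by (simp add: path_component_of_refl)
    ultimately show ?thesis by blast
  next
    case False
    have n: "Suc n = 1 + 1 * n" "2 \<le> 1 + 1 * n" using False by auto
    have A: "A \<in> unitary_group (1 + 1 * n)" using Suc.prems(2) by simp
    obtain B where B: "B \<in> unitary_group (1 * n)" "B \<in> real_matrices"
      "path_component_of (real_structure.R_topology (1 + 1 * n)) A (block 1 B)"
      by (rule real_structure.path_component_block'[OF A Suc.prems(3) n(2)]) blast
    obtain C where C: "C \<in> {1\<^sub>m n, last_diag n (- 1)}"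
      "path_component_of (real_structure.R_topology (1 * n)) B C"
      using Suc.IH[of B] B False by auto
    have "path_component_of (real_structure.R_topology (1 + 1 * n)) A (block 1 C)"
      using B(3) real_structure.path_component_block_mono[OF C(2)] by (rule path_component_of_trans)
    moreover have "block 1 C \<in> {1\<^sub>m (1 + n), last_diag (1 + n) (- 1)}"
      using C(1) False block_one[of 1 n] block_last_diag[of n 1] by auto
    ultimately show ?thesis by auto
  qed
qed simp

lemma unitary_map_cnj: "A \<in> unitary_group m \<Longrightarrow> map_mat cnj A \<in> unitary_group m"
proof (rule unitary_groupI)
  assume A: "A \<in> unitary_group m"
  note AD = unitary_groupD[OF A]
  interpret comm_ring_hom cnj by unfold_locales auto
  have "adj (map_mat cnj A) = map_mat cnj (adj A)" by (rule eq_matI) auto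
  then show "adj (map_mat cnj A) * map_mat cnj A = 1\<^sub>m m"
    using AD by (simp add: mat_hom_one flip: mat_hom_mult[of _ m m _ m])
qed (auto dest: unitary_groupD)

lemma mat_continuous_map_cnj:
  assumes F: "mat_continuous X r c F"
  shows "mat_continuous X r c (\<lambda>x. map_mat cnj (F x))"
proof (rule mat_continuousI)
  fix i j assume ij: "i < r" "j < c"
  have "continuous_map X euclidean (\<lambda>x. cnj (F x $$ (i, j)))"
    using mat_continuousD(2)[OF F ij] by (rule continuous_map_compose1) (intro continuous_intros)
  then show "continuous_map X euclidean (\<lambda>x. map_mat cnj (F x) $$ (i, j))"
    by (rule continuous_map_eq) (simp add: ij mat_continuous_dim[OF F])
qed (auto intro!: carrier_matI simp: mat_continuous_dim[OF F])

lemma unitary_involution_BDI: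
  assumes "0 < m"
  shows "unitary_involution m BDI_action"
proof
  show "continuous_map (unitary_topology m) (unitary_topology m) BDI_action"
    unfolding continuous_map_unitary_topology BDI_action_def
    by (auto intro: mat_continuous_map_cnj mat_continuous_id_unitary unitary_map_cnj)
  fix A assume A: "A \<in> unitary_group m"
  show "BDI_action (BDI_action A) = A" by (rule eq_matI) (auto simp: BDI_action_def)
  show "det (BDI_action A) = cnj (det A)"
    unfolding BDI_action_def by (rule det_map_cnj[OF unitary_groupD(1)[OF A]])
  assume "BDI_action A = A"
  moreover have "{A. BDI_action A = A} = real_matrices"
    by (auto simp: BDI_action_def real_matrices_iff)
  ultimately show "\<exists>B\<in>{1\<^sub>m m, last_diag m (- 1)}.
      path_component_of (subtopology (unitary_topology m) {A. BDI_action A = A}) A B"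
    using orthogonal_path_component[OF assms A] by auto
next
  show "BDI_action (1\<^sub>m m) = 1\<^sub>m m" by (rule eq_matI) (auto simp: BDI_action_def)
qed (rule assms)

section \<open>Class CII: quaternionic matrices and the symplectic group\<close>

definition mate :: "nat \<Rightarrow> nat" where
  "mate i = (if even i then Suc i else i - 1)"

definition mate_sign :: "nat \<Rightarrow> nat \<Rightarrow> complex" where
  "mate_sign i j = (if even i = even j then 1 else - 1)"

lemma mate_mate [simp]: "mate (mate i) = i"
  by (auto simp: mate_def elim!: oddE)

lemma mate_less: "even n \<Longrightarrow> i < n \<Longrightarrow> mate i < n"
  by (auto simp: mate_def elim!: evenE oddE)

lemma mate_eq_iff [simp]: "mate i = mate j \<longleftrightarrow> i = j"
  by (metis mate_mate)

lemma even_mate [simp]: "even (mate i) \<longleftrightarrow> odd i"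
  by (auto simp: mate_def)

lemma mate_sign_simps [simp]: "mate_sign i i = 1" "mate_sign (mate i) (mate j) = mate_sign i j"
  "cnj (mate_sign i j) = mate_sign i j" "mate_sign i j * mate_sign i j = 1"
  by (auto simp: mate_sign_def)

lemma mate_sign_trans: "mate_sign i l * mate_sign l j = mate_sign i j"
  by (auto simp: mate_sign_def)

lemma mate_sign_commute: "mate_sign i j = mate_sign j i"
  by (auto simp: mate_sign_def)

text \<open>\<open>mate\<close> exchanges the two indices of a pair, and \<open>mate_sign\<close> is
  -1 off the diagonal of a block. The condition therefore says that each \<open>2 \<times> 2\<close>
  block has rows (a, -cnj b) and (b, cnj a), the complex form of a quaternion.\<close>

definition quaternionic_matrices :: "complex mat set" where
  "quaternionic_matrices = {A. even (dim_row A) \<and> even (dim_col A) \<and>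
     (\<forall>i<dim_row A. \<forall>j<dim_col A. A $$ (mate i, mate j) = mate_sign i j * cnj (A $$ (i, j)))}"

lemma quaternionic_mult:
  assumes A: "A \<in> quaternionic_matrices" and B: "B \<in> quaternionic_matrices"
    and AB: "dim_col A = dim_row B"
  shows "A * B \<in> quaternionic_matrices"
proof -
  let ?n = "dim_row B"
  have ev: "even (dim_row A)" "even ?n" "even (dim_col B)"
    using A B by (auto simp: quaternionic_matrices_def)
  have "(A * B) $$ (mate i, mate j) = mate_sign i j * cnj ((A * B) $$ (i, j))"
    if ij: "i < dim_row A" "j < dim_col B" for i j
  proof -
    have mij: "mate i < dim_row A" "mate j < dim_col B" using ij ev by (auto intro: mate_less)
    have "(A * B) $$ (mate i, mate j) = (\<Sum>l\<in>{0..<?n}. A $$ (mate i, l) * B $$ (l, mate j))"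
      using mij AB by (simp add: scalar_prod_def)
    also have "\<dots> = (\<Sum>l\<in>{0..<?n}. A $$ (mate i, mate l) * B $$ (mate l, mate j))"
      \<comment> \<open>\<open>mate\<close> is an involution of the index range, since the inner
        dimension is even.\<close>
      by (rule sum.reindex_bij_witness[where i = mate and j = mate]) (use ev mate_less in auto)
    also have "\<dots> = (\<Sum>l\<in>{0..<?n}. mate_sign i j * cnj (A $$ (i, l) * B $$ (l, j)))"
    proof (rule sum.cong)
      fix l assume "l \<in> {0..<?n}"
      then have "A $$ (mate i, mate l) = mate_sign i l * cnj (A $$ (i, l))"
        "B $$ (mate l, mate j) = mate_sign l j * cnj (B $$ (l, j))"
        using A B AB ij by (auto simp: quaternionic_matrices_def)
      then show "A $$ (mate i, mate l) * B $$ (mate l, mate j) = mate_sign i j * cnj (A $$ (i, l) * B $$ (l, j))"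
        by (simp add: mult_ac flip: mate_sign_trans[of i l j])
    qed simp
    also have "\<dots> = mate_sign i j * cnj ((A * B) $$ (i, j))"
      using ij AB by (simp add: scalar_prod_def sum_distrib_left)
    finally show ?thesis .
  qed
  then show ?thesis using ev by (simp add: quaternionic_matrices_def)
qed

text \<open>With rows (a, -cnj b) and (b, cnj a) the two columns are orthogonal and have the same
  squared norm, that of the quaternion, so the first column alone determines it.\<close>

lemma quaternionic_norm:
  assumes c: "c \<in> quaternionic_matrices" "c \<in> carrier_mat 2 2"
  shows "adj c * c = complex_of_real (first_col_norm2 c) \<cdot>\<^sub>m 1\<^sub>m 2"
proof -
  have m: "mate 0 = 1" "mate 1 = 0" "mate (Suc 0) = 0" by (auto simp: mate_def)
  have c': "c $$ (mate i, mate j) = mate_sign i j * cnj (c $$ (i, j))" if "i < 2" "j < 2" for i j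
    using c that by (auto simp: quaternionic_matrices_def)
  have e: "c $$ (1, 1) = cnj (c $$ (0, 0))" "c $$ (0, 1) = - cnj (c $$ (1, 0))"
    using c'[of 0 0] c'[of 1 0] by (auto simp: m mate_sign_def)
  have N: "complex_of_real (first_col_norm2 c) = c $$ (0, 0) * cnj (c $$ (0, 0)) + c $$ (1, 0) * cnj (c $$ (1, 0))"
    using c(2) by (simp add: first_col_norm2_def numeral_2_eq_2 complex_norm_square[symmetric])
  show ?thesis
  proof (rule eq_matI)
    fix i j assume "i < dim_row (complex_of_real (first_col_norm2 c) \<cdot>\<^sub>m 1\<^sub>m 2)"
      "j < dim_col (complex_of_real (first_col_norm2 c) \<cdot>\<^sub>m 1\<^sub>m 2)"
    then have ij: "i = 0 \<or> i = 1" "j = 0 \<or> j = 1" by auto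
    then have "(adj c * c) $$ (i, j) = cnj (c $$ (0, i)) * c $$ (0, j) + cnj (c $$ (1, i)) * c $$ (1, j)"
      using c(2) by (auto simp: scalar_prod_def numeral_2_eq_2)
    also have "\<dots> = (if i = j then complex_of_real (first_col_norm2 c) else 0)"
      unfolding N using ij e by (auto simp: algebra_simps)
    finally show "(adj c * c) $$ (i, j) = (complex_of_real (first_col_norm2 c) \<cdot>\<^sub>m 1\<^sub>m 2) $$ (i, j)"
      using ij by auto
  qed (use c in auto)
qed

lemma mate_add_2 [simp]: "mate (i + 2) = mate i + 2"
  by (auto simp: mate_def)

lemma mate_sign_add_2 [simp]: "mate_sign (i + 2) (j + 2) = mate_sign i j"
  by (auto simp: mate_sign_def)

lemma mate_less_2 [simp]: "mate i < 2 \<longleftrightarrow> i < 2"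
  by (auto simp: mate_def elim!: oddE)

lemma quaternionic_block:
  assumes A: "A \<in> carrier_mat (2 * n) (2 * n)"
  shows "block 2 A \<in> quaternionic_matrices \<longleftrightarrow> A \<in> quaternionic_matrices"
proof
  assume L: "block 2 A \<in> quaternionic_matrices"
  have "A $$ (mate i, mate j) = mate_sign i j * cnj (A $$ (i, j))" if ij: "i < 2 * n" "j < 2 * n" for i j
  proof -
    have mij: "mate i < 2 * n" "mate j < 2 * n" using ij by (auto intro: mate_less)
    have "block 2 A $$ (mate (i + 2), mate (j + 2)) = mate_sign (i + 2) (j + 2) * cnj (block 2 A $$ (i + 2, j + 2))"
      using L A ij unfolding quaternionic_matrices_def by (auto simp del: mate_add_2 mate_sign_add_2)
    then show ?thesis using A ij mij unfolding mate_add_2 mate_sign_add_2 by (simp add: block_index)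
  qed
  then show "A \<in> quaternionic_matrices" using A by (auto simp: quaternionic_matrices_def)
next
  assume R: "A \<in> quaternionic_matrices"
  have "block 2 A $$ (mate i, mate j) = mate_sign i j * cnj (block 2 A $$ (i, j))"
    if ij: "i < 2 + 2 * n" "j < 2 + 2 * n" for i j
  proof -
    have mij: "mate i < 2 + 2 * n" "mate j < 2 + 2 * n" using ij by (auto intro: mate_less)
    show ?thesis
    proof (cases "i < 2 \<or> j < 2")
      case True
      then show ?thesis using A ij mij by (auto simp: block_index)
    next
      case False
      define i' j' where "i' = i - 2" and "j' = j - 2"
      have i: "i = i' + 2" "j = j' + 2" and ij': "i' < 2 * n" "j' < 2 * n"
        using False ij by (auto simp: i'_def j'_def)
      then show ?thesis
        using A R mate_less[of "2 * n"] unfolding i mate_add_2 mate_sign_add_2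
        by (simp add: block_index quaternionic_matrices_def)
    qed
  qed
  then show "block 2 A \<in> quaternionic_matrices" using A by (auto simp: quaternionic_matrices_def)
qed

lemma quaternionic_givens:
  assumes "2 \<le> 2 * (n::nat)"
  shows "givens (2 * n) \<theta> \<in> quaternionic_matrices"
proof -
  have "givens (2 * n) \<theta> $$ (mate i, mate j) = mate_sign i j * cnj (givens (2 * n) \<theta> $$ (i, j))"
    if ij: "i < 2 * n" "j < 2 * n" for i j
  proof -
    have mij: "mate i < 2 * n" "mate j < 2 * n" using ij by (auto intro: mate_less)
    have "mate i = 0 \<longleftrightarrow> i = 1" "i < 2 \<longleftrightarrow> i = 0 \<or> i = 1" "j < 2 \<longleftrightarrow> j = 0 \<or> j = 1"
      by (auto simp: mate_def le_Suc_eq)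
    then show ?thesis
      using assms ij mij by (cases "i < 2 \<and> j < 2") (auto simp: givens_index mate_sign_def)
  qed
  then show ?thesis by (simp add: quaternionic_matrices_def givens_dim[OF assms])
qed

interpretation quaternionic_structure: block_star_algebra 2 quaternionic_matrices
proof
  fix A assume A: "A \<in> quaternionic_matrices"
  have "adj A $$ (mate i, mate j) = mate_sign i j * cnj (adj A $$ (i, j))"
    if "i < dim_col A" "j < dim_row A" for i j
    using A that mate_sign_commute[of i j] mate_less
    by (auto simp: quaternionic_matrices_def)
  then show "adj A \<in> quaternionic_matrices" using A by (auto simp: quaternionic_matrices_def)
next
  fix A B assume "A \<in> quaternionic_matrices" "B \<in> quaternionic_matrices"
    "dim_row A = dim_row B" "dim_col A = dim_col B"
  then show "A + B \<in> quaternionic_matrices"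
    by (auto simp: quaternionic_matrices_def mate_less algebra_simps)
next
  fix A a assume "A \<in> quaternionic_matrices"
  then show "complex_of_real a \<cdot>\<^sub>m A \<in> quaternionic_matrices"
    by (auto simp: quaternionic_matrices_def mate_less)
next
  show "1\<^sub>m (2 * n) \<in> quaternionic_matrices" for n
    by (auto simp: quaternionic_matrices_def mate_less)
next
  show "frame (2 + 2 * n) 2 \<in> quaternionic_matrices" for n
    by (auto simp: quaternionic_matrices_def mate_less)
qed (simp_all add: quaternionic_mult quaternionic_norm quaternionic_block quaternionic_givens)

text \<open>Here the induction descends to the empty matrix instead of a sign: splitting off a pair
  of coordinates always has room for the half turn, so a single component remains.\<close>

lemma symplectic_path_component:
  assumes "A \<in> unitary_group (2 * n)" "A \<in> quaternionic_matrices"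
  shows "path_component_of (subtopology (unitary_topology (2 * n)) quaternionic_matrices) A (1\<^sub>m (2 * n))"
  using assms
proof (induction n arbitrary: A)
  case 0
  then have "A = 1\<^sub>m (2 * 0)" by (intro eq_matI) (auto dest: unitary_groupD)
  then show ?case using 0 by (simp add: path_component_of_refl)
next
  case (Suc n)
  have n: "2 * Suc n = 2 + 2 * n" by simp
  obtain B where B: "B \<in> unitary_group (2 * n)" "B \<in> quaternionic_matrices"
    "path_component_of (quaternionic_structure.R_topology (2 + 2 * n)) A (block 2 B)"
    using quaternionic_structure.path_component_block'[of A n] Suc.prems unfolding n by auto
  have "path_component_of (quaternionic_structure.R_topology (2 + 2 * n)) A (block 2 (1\<^sub>m (2 * n)))"
    using B(3) quaternionic_structure.path_component_block_mono[OF Suc.IH[OF B(1,2)]]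
    by (rule path_component_of_trans)
  then show ?case unfolding n block_one .
qed

abbreviation sigma_block :: "nat \<Rightarrow> complex mat" where
  "sigma_block m \<equiv> kronecker_mat (1\<^sub>m (m div 2)) sigma2"

lemma sigma_block_carrier: "even m \<Longrightarrow> sigma_block m \<in> carrier_mat m m"
  by (rule carrier_matI) (auto simp: kronecker_mat_def sigma2_def mat_of_rows_list_def)

text \<open>Each row has exactly one nonzero entry, in the column of its partner. Multiplication by
  this matrix therefore permutes indices by \<open>mate\<close> up to factors \<i> and
  -\<i>.\<close>

lemma sigma_block_index:
  assumes m: "even m" and ij: "i < m" "j < m"
  shows "sigma_block m $$ (i, j) = (if j = mate i then if even i then - \<i> else \<i> else 0)"
proof -
  have s: "dim_row sigma2 = 2" "dim_col sigma2 = 2"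
    "sigma2 $$ (0, 0) = 0" "sigma2 $$ (0, 1) = - \<i>" "sigma2 $$ (1, 0) = \<i>" "sigma2 $$ (1, 1) = 0"
    by (auto simp: sigma2_def mat_of_rows_list_def)
  have d: "i div 2 < m div 2" "j div 2 < m div 2" and m2: "m div 2 * 2 = m"
    using m ij by auto
  have "sigma_block m $$ (i, j) = (if i div 2 = j div 2 then 1 else 0) * sigma2 $$ (i mod 2, j mod 2)"
    using d ij m2 by (simp add: kronecker_mat_def s)
  also have "\<dots> = (if j = mate i then if even i then - \<i> else \<i> else 0)"
  proof (cases "even i"; cases "even j")
    assume "even i" "even j"
    then show ?thesis using s by (auto simp: mate_def elim!: evenE; presburger)
  next
    assume "even i" "odd j"
    then show ?thesis using s by (auto simp: mate_def elim!: evenE oddE; presburger)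
  next
    assume "odd i" "even j"
    then show ?thesis using s by (auto simp: mate_def elim!: evenE oddE; presburger)
  next
    assume "odd i" "odd j"
    then show ?thesis using s by (auto simp: mate_def elim!: oddE; presburger)
  qed
  finally show ?thesis .
qed

lemma sigma_block_mult_index:
  assumes m: "even m" and A: "A \<in> carrier_mat m m" and ij: "i < m" "j < m"
  shows "(sigma_block m * A) $$ (i, j) = (if even i then - \<i> else \<i>) * A $$ (mate i, j)"
    "(A * sigma_block m) $$ (i, j) = A $$ (i, mate j) * (if even j then \<i> else - \<i>)"
proof -
  note S = sigma_block_carrier[OF m]
  have mi: "mate i < m" "mate j < m" using m ij by (auto intro: mate_less)
  have "(sigma_block m * A) $$ (i, j) = (\<Sum>l\<in>{0..<m}. sigma_block m $$ (i, l) * A $$ (l, j))"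
    using carrier_matD[OF S] carrier_matD[OF A] ij by (simp add: scalar_prod_def)
  also have "\<dots> = (\<Sum>l\<in>{0..<m}. if l = mate i then (if even i then - \<i> else \<i>) * A $$ (mate i, j) else 0)"
    using m ij by (intro sum.cong) (auto simp: sigma_block_index)
  finally show "(sigma_block m * A) $$ (i, j) = (if even i then - \<i> else \<i>) * A $$ (mate i, j)"
    using mi by simp
  have "(A * sigma_block m) $$ (i, j) = (\<Sum>l\<in>{0..<m}. A $$ (i, l) * sigma_block m $$ (l, j))"
    using carrier_matD[OF S] carrier_matD[OF A] ij by (simp add: scalar_prod_def)
  also have "\<dots> = (\<Sum>l\<in>{0..<m}. if l = mate j then A $$ (i, mate j) * (if even j then \<i> else - \<i>) else 0)"
  proof (rule sum.cong)
    fix l assume "l \<in> {0..<m}"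
    moreover have "j = mate l \<longleftrightarrow> l = mate j" by (metis mate_mate)
    ultimately show "A $$ (i, l) * sigma_block m $$ (l, j) = (if l = mate j then A $$ (i, mate j) * (if even j then \<i> else - \<i>) else 0)"
      using m ij by (auto simp: sigma_block_index)
  qed simp
  finally show "(A * sigma_block m) $$ (i, j) = A $$ (i, mate j) * (if even j then \<i> else - \<i>)"
    using mi by simp
qed

lemma sigma_block_square: "even m \<Longrightarrow> sigma_block m * sigma_block m = 1\<^sub>m m"
  using sigma_block_carrier[of m] mate_less[of m]
  by (intro eq_matI) (auto simp: sigma_block_mult_index(1) sigma_block_index simp del: index_mult_mat(1))

lemma unitary_sigma_block:
  assumes m: "even m"
  shows "sigma_block m \<in> unitary_group m"
proof (rule unitary_groupI[OF sigma_block_carrier[OF m]])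
  have "i = mate j \<longleftrightarrow> j = mate i" for i j by (metis mate_mate)
  then have "adj (sigma_block m) = sigma_block m"
    using sigma_block_carrier[OF m] by (intro eq_matI) (auto simp: sigma_block_index[OF m])
  then show "adj (sigma_block m) * sigma_block m = 1\<^sub>m m" by (simp add: sigma_block_square[OF m])
qed

lemma CII_action_carrier: "\<lbrakk>even m; A \<in> carrier_mat m m\<rbrakk> \<Longrightarrow> CII_action m A \<in> carrier_mat m m"
  unfolding CII_action_def using sigma_block_carrier[of m] by auto

text \<open>The factors from the two sides are -\<i> or \<i> by the parity of the row and \<i> or
  -\<i> by that of the column; their product is 1 for equal parities and -1 otherwise, which is
  \<open>mate_sign\<close>.\<close>

lemma CII_action_index:
  assumes m: "even m" and A: "A \<in> carrier_mat m m" and ij: "i < m" "j < m"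
  shows "CII_action m A $$ (i, j) = mate_sign i j * cnj (A $$ (mate i, mate j))"
proof -
  have B: "sigma_block m * map_mat cnj A \<in> carrier_mat m m"
    using sigma_block_carrier[OF m] A by auto
  have mij: "mate i < m" "mate j < m" using m ij by (auto intro: mate_less)
  show ?thesis
    unfolding CII_action_def sigma_block_mult_index(2)[OF m B ij]
    using A ij mij m
    by (subst sigma_block_mult_index(1)) (auto simp: mate_sign_def)
qed

lemma CII_fixed_iff:
  assumes m: "even m" and A: "A \<in> carrier_mat m m"
  shows "CII_action m A = A \<longleftrightarrow> A \<in> quaternionic_matrices"
proof -
  have "CII_action m A = A \<longleftrightarrow> (\<forall>i<m. \<forall>j<m. mate_sign i j * cnj (A $$ (mate i, mate j)) = A $$ (i, j))"
    using carrier_matD[OF CII_action_carrier[OF m A]] carrier_matD[OF A]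
    by (auto simp: mat_eq_iff CII_action_index[OF m A])
  also have "\<dots> \<longleftrightarrow> (\<forall>i<m. \<forall>j<m. A $$ (mate i, mate j) = mate_sign i j * cnj (A $$ (i, j)))"
  proof (intro iffI allI impI)
    fix i j assume *: "\<forall>i<m. \<forall>j<m. mate_sign i j * cnj (A $$ (mate i, mate j)) = A $$ (i, j)" "i < m" "j < m"
    \<comment> \<open>Substituting the partners for both indices moves \<open>mate\<close> to the
      other side, since it is an involution that preserves the sign.\<close>
    have "mate_sign (mate i) (mate j) * cnj (A $$ (mate (mate i), mate (mate j))) = A $$ (mate i, mate j)"
      using * mate_less[OF m] by blast
    then show "A $$ (mate i, mate j) = mate_sign i j * cnj (A $$ (i, j))" by simp
  next
    fix i j assume *: "\<forall>i<m. \<forall>j<m. A $$ (mate i, mate j) = mate_sign i j * cnj (A $$ (i, j))" "i < m" "j < m"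
    then show "mate_sign i j * cnj (A $$ (mate i, mate j)) = A $$ (i, j)"
      by (simp add: mult.assoc[symmetric])
  qed
  finally show ?thesis using m A by (auto simp: quaternionic_matrices_def)
qed

lemma unitary_involution_CII:
  assumes m: "0 < m" "even m"
  shows "unitary_involution m (CII_action m)"
proof
  note S = sigma_block_carrier[OF m(2)] and SU = unitary_sigma_block[OF m(2)]
  show "continuous_map (unitary_topology m) (unitary_topology m) (CII_action m)"
    unfolding continuous_map_unitary_topology CII_action_def
    by (auto intro!: mat_continuous_mult[of _ _ m] mat_continuous_const S mat_continuous_map_cnj
        mat_continuous_id_unitary unitary_group_mult SU unitary_map_cnj)
  fix A assume A: "A \<in> unitary_group m"
  note AC = unitary_groupD(1)[OF A]
  note GA = CII_action_carrier[OF m(2) AC]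
  show "CII_action m (CII_action m A) = A"
  proof (rule eq_matI)
    fix i j assume "i < dim_row A" "j < dim_col A"
    then show "CII_action m (CII_action m A) $$ (i, j) = A $$ (i, j)"
      using AC mate_less[OF m(2)]
      by (simp add: CII_action_index[OF m(2) GA] CII_action_index[OF m(2) AC] mult.assoc[symmetric])
  qed (use AC CII_action_carrier[OF m(2) GA] in auto)
  \<comment> \<open>The matrix on both sides is its own inverse, so its determinant enters squared
    and disappears.\<close>
  have "det (sigma_block m) * det (sigma_block m) = 1"
    using det_mult[OF S S] by (simp add: sigma_block_square[OF m(2)])
  moreover have "det (CII_action m A) = det (sigma_block m) * cnj (det A) * det (sigma_block m)"
    unfolding CII_action_def using S AC by (simp add: det_mult[of _ m] det_map_cnj)
  ultimately show "det (CII_action m A) = cnj (det A)" by (simp add: mult_ac)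
  assume "CII_action m A = A"
  then have AQ: "A \<in> quaternionic_matrices" using CII_fixed_iff[OF m(2) AC] by simp
  obtain n where n: "m = 2 * n" using m(2) by blast
  \<comment> \<open>\<open>quaternionic_matrices\<close> contains matrices of all even shapes and is
    compared with the fixed set only for size \<open>m\<close>. The subspaces agree because only the
    intersection with the unitary group matters.\<close>
  have "subtopology (unitary_topology m) quaternionic_matrices
      = subtopology (unitary_topology m) (unitary_group m \<inter> quaternionic_matrices)"
    by (metis subtopology_restrict topspace_unitary_topology)
  also have "unitary_group m \<inter> quaternionic_matrices = unitary_group m \<inter> {A. CII_action m A = A}"
    using CII_fixed_iff[OF m(2)] unitary_groupD(1) by blast
  also have "subtopology (unitary_topology m) \<dots> = subtopology (unitary_topology m) {A. CII_action m A = A}"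
    by (metis subtopology_restrict topspace_unitary_topology)
  finally show "\<exists>B\<in>{1\<^sub>m m, last_diag m (- 1)}.
      path_component_of (subtopology (unitary_topology m) {A. CII_action m A = A}) A B"
    using symplectic_path_component[of A n] A AQ unfolding n by auto
next
  show "CII_action m (1\<^sub>m m) = 1\<^sub>m m"
    using CII_fixed_iff[OF m(2), of "1\<^sub>m m"] quaternionic_structure.R_one[of "m div 2"] m by simp
qed (rule m)

theorem mainTheorem4:
  fixes m :: nat
  assumes "m \<ge> 1"
  shows "(\<exists>\<phi>. bij_betw \<phi> (equivariant_loop_classes (unitary_topology m) BDI_action (1\<^sub>m m)) (UNIV :: int set)) \<and>
         (even m \<longrightarrow>
           (\<exists>\<phi>. bij_betw \<phi> (equivariant_loop_classes (unitary_topology m) (CII_action m) (1\<^sub>m m)) (UNIV :: int set)))"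
proof (intro conjI impI)
  have m: "0 < m" using assms by simp
  show "\<exists>\<phi>. bij_betw \<phi> (equivariant_loop_classes (unitary_topology m) BDI_action (1\<^sub>m m)) (UNIV :: int set)"
    by (rule unitary_involution.loop_classes_bij_int[OF unitary_involution_BDI[OF m]])
  show "\<exists>\<phi>. bij_betw \<phi> (equivariant_loop_classes (unitary_topology m) (CII_action m) (1\<^sub>m m)) (UNIV :: int set)"
    if "even m"
    by (rule unitary_involution.loop_classes_bij_int[OF unitary_involution_CII[OF m that]])
qed

end
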